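(* Let $G$ be the allowed isometry group and let $K\subset\mathbb{R}^d$ be a self-nesting body (with respect to $G$). Then every uniformly recurrent, dense packing $\mathcal{P}$ of $K$ is limit-equivalent to a completely saturated packing of $K$.
   Context: A domain is a subset of $\mathbb{R}^d$ that is the closure of its interior; a body is a compact domain. Fix a group $G$ of isometries of $\mathbb{R}^d$ containing all translations (for example the group of all isometries, or the group of all translations), called the allowed isometry group; "copy of $K$" means a set $gK$ with $g\in G$. A packing of $K$ is a collection of copies of $K$ whose elements have pairwise disjoint interiors. $K$ is self-nesting if for every $\epsilon>0$ there exists $g\in G$ such that $gK$ lies in the interior of $(1+\epsilon)K$. A packing is $n$-saturated if it is not possible to replace any $n-1$ of its elements by $n$ copies of $K$ and still have a packing; it is completely saturated if it is $n$-saturated for all $n$. Density: $$\delta(\mathcal{P})=\lim_{r\to\infty}\frac{\sum_{D\in\mathcal{P}}\mathrm{Vol}(B(p,r)\cap D)}{\mathrm{Vol}\,B(p,r)}$$ when the limit exists, for any fixed $p\in\mathbb{R}^d$, where $B(p,r)$ is the round ball of radius $r$ centered at $p$. The packing density $\delta(K)$ is the supremum of $\delta(\mathcal{P})$ over packings $\mathcal{P}$ of $K$, and $\mathcal{P}$ is dense if it has maximum density, $\delta(\mathcal{P})=\delta(K)$. Topology: for collections of domains $\mathcal{P},\mathcal{Q}$, the modified Hausdorff distance satisfies $d(\mathcal{P},\mathcal{Q})\le\epsilon$ when there is a binary relation $A\sim B$ between elements $A\in\mathcal{P}$ and $B\in\mathcal{Q}$ such that $A\sim B$ implies that the Hausdorff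 distance between $A$ and $B$ is at most $\epsilon$; for each $A\in\mathcal{P}$ in the ball $B(0,1/\epsilon)$ there is a unique $B\in\mathcal{Q}$ with $A\sim B$; and for each $B\in\mathcal{Q}$ in $B(0,1/\epsilon)$ there is a unique $A\in\mathcal{P}$ with $A\sim B$. Convergence of packings is with respect to the induced (Hausdorff) topology. A packing $\mathcal{A}$ is a limit of a packing $\mathcal{B}$, written $\mathcal{A}\succeq_L\mathcal{B}$, if some sequence of translates of $\mathcal{B}$ converges to $\mathcal{A}$. A packing $\mathcal{A}$ is uniformly recurrent if it is maximal for this reflexive transitive relation: whenever $\mathcal{B}\succeq_L\mathcal{A}$, also $\mathcal{A}\succeq_L\mathcal{B}$. Two packings $\mathcal{A},\mathcal{B}$ are limit-equivalent if $\mathcal{A}\succeq_L\mathcal{B}$ and $\mathcal{B}\succeq_L\mathcal{A}$.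
   Formalization: The allowed isometry group G is additionally assumed closed (under pointwise limits), since the claim fails for some non-closed G, e.g. translations with a countable dense group of rotations and K a square; bodies are taken nonempty. *)

theory Defs
  imports "HOL-Analysis.Analysis"
begin

definition isometry_group :: "('a::euclidean_space \<Rightarrow> 'a) set \<Rightarrow> bool" where
  "isometry_group G \<longleftrightarrow>
     (\<forall>g\<in>G. bij g \<and> (\<forall>x y. dist (g x) (g y) = dist x y)) \<and>
     id \<in> G \<and> (\<forall>g\<in>G. \<forall>h\<in>G. g \<circ> h \<in> G) \<and> (\<forall>g\<in>G. inv g \<in> G)"

definition allowed_isometry_group :: "('a::euclidean_space \<Rightarrow> 'a) set \<Rightarrow> bool" where
  "allowed_isometry_group G \<longleftrightarrow> isometry_group G \<and> (\<forall>v. (+) v \<in> G)"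

definition domain :: "'a::euclidean_space set \<Rightarrow> bool" where
  "domain K \<longleftrightarrow> K = closure (interior K)"

text \<open>The empty set is the closure of its interior, but Hausdorff distances and packing
  densities are only meaningful for nonempty sets, so it is not counted as a body.\<close>

definition body :: "'a::euclidean_space set \<Rightarrow> bool" where
  "body K \<longleftrightarrow> domain K \<and> compact K \<and> K \<noteq> {}"

definition copies :: "('a::euclidean_space \<Rightarrow> 'a) set \<Rightarrow> 'a set \<Rightarrow> 'a set set" where
  "copies G K = {g ` K | g. g \<in> G}"

text \<open>A packing is a set of copies. For a body \<open>K\<close> no packing could use a copy twice,
  since the interior of a copy is nonempty.\<close>

definition packing :: "('a::euclidean_space \<Rightarrow> 'a) set \<Rightarrow> 'a set \<Rightarrow> 'a set set \<Rightarrow> bool" where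
  "packing G K P \<longleftrightarrow>
     P \<subseteq> copies G K \<and> pairwise (\<lambda>A B. interior A \<inter> interior B = {}) P"

definition self_nesting :: "('a::euclidean_space \<Rightarrow> 'a) set \<Rightarrow> 'a set \<Rightarrow> bool" where
  "self_nesting G K \<longleftrightarrow>
     (\<forall>\<epsilon>>0. \<exists>g\<in>G. g ` K \<subseteq> interior ((\<lambda>x. (1 + \<epsilon>) *\<^sub>R x) ` K))"

text \<open>The inserted copies \<open>T\<close> must not occur in \<open>P - S\<close>: otherwise the
  set union would absorb them.  They may occur in \<open>S\<close>.\<close>

definition n_saturated ::
  "('a::euclidean_space \<Rightarrow> 'a) set \<Rightarrow> 'a set \<Rightarrow> nat \<Rightarrow> 'a set set \<Rightarrow> bool" where
  "n_saturated G K n P \<longleftrightarrow>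
     \<not> (\<exists>S T. S \<subseteq> P \<and> finite S \<and> card S = n - 1 \<and>
              T \<subseteq> copies G K \<and> finite T \<and> card T = n \<and>
              T \<inter> (P - S) = {} \<and> packing G K ((P - S) \<union> T))"

definition completely_saturated ::
  "('a::euclidean_space \<Rightarrow> 'a) set \<Rightarrow> 'a set \<Rightarrow> 'a set set \<Rightarrow> bool" where
  "completely_saturated G K P \<longleftrightarrow> (\<forall>n\<ge>1. n_saturated G K n P)"

definition has_density :: "'a::euclidean_space set set \<Rightarrow> real \<Rightarrow> bool" where
  "has_density P c \<longleftrightarrow>
     (\<forall>p. ((\<lambda>r. (\<Sum>\<^sub>\<infinity>D\<in>P. measure lborel (ball p r \<inter> D)) / measure lborel (ball p r))
            \<longlongrightarrow> c) at_top)"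

definition packing_density :: "('a::euclidean_space \<Rightarrow> 'a) set \<Rightarrow> 'a set \<Rightarrow> real" where
  "packing_density G K = Sup {c. \<exists>P. packing G K P \<and> has_density P c}"

definition dense_packing ::
  "('a::euclidean_space \<Rightarrow> 'a) set \<Rightarrow> 'a set \<Rightarrow> 'a set set \<Rightarrow> bool" where
  "dense_packing G K P \<longleftrightarrow> packing G K P \<and> has_density P (packing_density G K)"

text \<open>Only applied to nonempty compact sets, where the suprema are attained.\<close>

definition hausdorff_dist :: "'a::metric_space set \<Rightarrow> 'a set \<Rightarrow> real" where
  "hausdorff_dist A B = max (SUP a\<in>A. infdist a B) (SUP b\<in>B. infdist b A)"

text \<open>\<open>mod_hausdorff_le P Q \<epsilon>\<close> says that the modified Hausdorff distance
  between \<open>P\<close> and \<open>Q\<close> is at most \<open>\<epsilon>\<close>; it is monotone in \<open>\<epsilon>\<close>.\<close>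

definition mod_hausdorff_le ::
  "'a::euclidean_space set set \<Rightarrow> 'a set set \<Rightarrow> real \<Rightarrow> bool" where
  "mod_hausdorff_le P Q \<epsilon> \<longleftrightarrow>
     (\<exists>R :: 'a set \<Rightarrow> 'a set \<Rightarrow> bool.
        (\<forall>A\<in>P. \<forall>B\<in>Q. R A B \<longrightarrow> hausdorff_dist A B \<le> \<epsilon>) \<and>
        (\<forall>A\<in>P. A \<subseteq> cball 0 (1 / \<epsilon>) \<longrightarrow> (\<exists>!B. B \<in> Q \<and> R A B)) \<and>
        (\<forall>B\<in>Q. B \<subseteq> cball 0 (1 / \<epsilon>) \<longrightarrow> (\<exists>!A. A \<in> P \<and> R A B)))"

definition packings_converge ::
  "(nat \<Rightarrow> 'a::euclidean_space set set) \<Rightarrow> 'a set set \<Rightarrow> bool" where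
  "packings_converge X Q \<longleftrightarrow>
     (\<forall>\<epsilon>>0. eventually (\<lambda>k. mod_hausdorff_le (X k) Q \<epsilon>) sequentially)"

definition translate :: "'a::euclidean_space \<Rightarrow> 'a set set \<Rightarrow> 'a set set" where
  "translate v P = (\<lambda>D. (+) v ` D) ` P"

text \<open>\<open>limit_of A B\<close>: the packing \<open>A\<close> is a limit of translates of \<open>B\<close>.\<close>

definition limit_of :: "'a::euclidean_space set set \<Rightarrow> 'a set set \<Rightarrow> bool" where
  "limit_of A B \<longleftrightarrow> (\<exists>t :: nat \<Rightarrow> 'a. packings_converge (\<lambda>k. translate (t k) B) A)"

definition uniformly_recurrent ::
  "('a::euclidean_space \<Rightarrow> 'a) set \<Rightarrow> 'a set \<Rightarrow> 'a set set \<Rightarrow> bool" where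
  "uniformly_recurrent G K A \<longleftrightarrow>
     packing G K A \<and> (\<forall>B. packing G K B \<and> limit_of B A \<longrightarrow> limit_of A B)"

definition limit_equivalent :: "'a::euclidean_space set set \<Rightarrow> 'a set set \<Rightarrow> bool" where
  "limit_equivalent A B \<longleftrightarrow> limit_of A B \<and> limit_of B A"

end

theory Submission
  imports Defs "HOL-Library.Diagonal_Subsequence"
begin

text \<open>
  Say that a packing is \<open>m\<close>-swappable if some of its elements inside the ball of radius \<open>m\<close> about
  the origin can be replaced by one more copy of \<open>K\<close> inside that ball. A packing is completely
  saturated iff it is \<open>m\<close>-swappable for no \<open>m\<close>, and being \<open>m\<close>-swappable is a closed condition, by
  sequential compactness of the space of packings.

  If the translates of \<open>P\<close> by a relatively dense set were \<open>m\<close>-swappable, then disjoint swaps could be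
  carried out throughout a large cube. The gain is proportional to the volume of the cube, so it
  outweighs the boundary loss that arises when the result is repeated periodically, and \<open>P\<close> would not
  be dense. On the other hand, the translates of a uniformly recurrent \<open>P\<close> return to any
  neighbourhood along a relatively dense set. Hence near every translate of \<open>P\<close> there is one that is
  not \<open>m\<close>-swappable, and a Baire category argument yields a limit of translates of \<open>P\<close> that is
  not \<open>m\<close>-swappable for any \<open>m\<close>; uniform recurrence makes it limit-equivalent to \<open>P\<close>.
\<close>

section \<open>Hausdorff distance and isometries\<close>

text \<open>Hausdorff distance by itself sees neither interiors nor multiplicities, while a swap is
  about both. Two facts bridge this gap. Elements of one packing closer than \<open>inradius\<close>
  coincide, so matchings between nearby packings are unique, and cardinalities and disjointness pass
  to limits; this uses that \<open>K\<close> is the closure of its interior. A point interior to a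
  copy stays interior to all copies near it, so disjointness of interiors passes to limits as well;
  this uses that the copies inside a ball are images of \<open>K\<close> under a sequentially
  compact family of isometries. For a single \<open>m\<close>, some translate of \<open>P\<close>
  would already do. But that translate depends on \<open>m\<close>, so one packing for all
  \<open>m\<close> has to be a limit, and stability of the absence of swaps under small changes
  keeps the conditions already met from being lost on the way.\<close>

lemma hausdorff_dist_le_iff:
  fixes A B :: "'a::heine_borel set"
  assumes "compact A" "compact B" "A \<noteq> {}" "B \<noteq> {}"
  shows "hausdorff_dist A B \<le> e \<longleftrightarrow>
    (\<forall>a\<in>A. \<exists>b\<in>B. dist a b \<le> e) \<and> (\<forall>b\<in>B. \<exists>a\<in>A. dist a b \<le> e)"
proof -
  have bdd: "bdd_above ((\<lambda>x. infdist x T) ` S)" if "compact S" for S T :: "'a set"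
    by (intro bounded_imp_bdd_above compact_imp_bounded compact_continuous_image that
        continuous_intros)
  \<comment> \<open>Compactness of \<open>T\<close> makes the infimum in \<open>infdist\<close>
    attained, so a bound on it is witnessed by an actual point.\<close>
  have att: "infdist x T \<le> e \<longleftrightarrow> (\<exists>y\<in>T. dist x y \<le> e)" if "compact T" "T \<noteq> {}" for x and T :: "'a set"
    using infdist_attains_inf[of T x] that infdist_le2 compact_imp_closed by metis
  have "(SUP x\<in>S. infdist x T) \<le> e \<longleftrightarrow> (\<forall>x\<in>S. \<exists>y\<in>T. dist x y \<le> e)"
    if "compact S" "S \<noteq> {}" "compact T" "T \<noteq> {}" for S T :: "'a set"
    using that bdd att by (simp add: cSUP_le_iff)
  then show ?thesis
    using assms unfolding hausdorff_dist_def by (simp add: dist_commute)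
qed

lemma hausdorff_dist_commute: "hausdorff_dist A B = hausdorff_dist B A"
  by (simp add: hausdorff_dist_def max.commute)

lemma hausdorff_dist_triangle_le:
  fixes A B C :: "'a::heine_borel set"
  assumes "compact A" "compact B" "compact C" "A \<noteq> {}" "B \<noteq> {}" "C \<noteq> {}"
    and "hausdorff_dist A B \<le> d" "hausdorff_dist B C \<le> e"
  shows "hausdorff_dist A C \<le> d + e"
proof -
  have AB: "\<forall>a\<in>A. \<exists>b\<in>B. dist a b \<le> d" "\<forall>b\<in>B. \<exists>a\<in>A. dist a b \<le> d"
    and BC: "\<forall>b\<in>B. \<exists>c\<in>C. dist b c \<le> e" "\<forall>c\<in>C. \<exists>b\<in>B. dist b c \<le> e"
    using assms by (simp_all add: hausdorff_dist_le_iff)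
  have "\<forall>a\<in>A. \<exists>c\<in>C. dist a c \<le> d + e"
    using AB(1) BC(1) by (meson add_mono dist_triangle order_trans)
  moreover have "\<forall>c\<in>C. \<exists>a\<in>A. dist a c \<le> d + e"
    using AB(2) BC(2) by (meson add_mono dist_triangle order_trans)
  ultimately show ?thesis
    using assms by (simp add: hausdorff_dist_le_iff)
qed

lemma hausdorff_dist_self_le:
  fixes A :: "'a::heine_borel set"
  assumes "compact A" "A \<noteq> {}" "0 \<le> e"
  shows "hausdorff_dist A A \<le> e"
  using assms by (simp add: hausdorff_dist_le_iff) (metis dist_self)

lemma hausdorff_dist_eqI:
  fixes A B :: "'a::heine_borel set"
  assumes "compact A" "compact B" "A \<noteq> {}" "B \<noteq> {}"
    and "\<And>e. 0 < e \<Longrightarrow> hausdorff_dist A B \<le> e"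
  shows "A = B"
proof -
  have *: "\<forall>e>0. (\<forall>a\<in>A. \<exists>b\<in>B. dist a b \<le> e) \<and> (\<forall>b\<in>B. \<exists>a\<in>A. dist a b \<le> e)"
    using assms by (simp add: hausdorff_dist_le_iff)
  have "a \<in> closure B" if "a \<in> A" for a
    using * that unfolding closure_approachable_le by (metis dist_commute)
  moreover have "b \<in> closure A" if "b \<in> B" for b
    using * that unfolding closure_approachable_le by simp
  ultimately show ?thesis
    using assms(1,2) by (auto simp: compact_imp_closed)
qed

lemma hausdorff_dist_subset_cball:
  fixes A B :: "'a::euclidean_space set"
  assumes "compact A" "compact B" "A \<noteq> {}" "B \<noteq> {}"
    and "hausdorff_dist A B \<le> e" "A \<subseteq> cball 0 r" "r + e \<le> s"
  shows "B \<subseteq> cball 0 s"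
proof
  fix b assume "b \<in> B"
  then obtain a where "a \<in> A" "dist a b \<le> e"
    using hausdorff_dist_le_iff[OF assms(1-4), of e] assms(5) by blast
  with assms show "b \<in> cball 0 s"
    using dist_triangle[of 0 b a] by (force simp: subset_iff)
qed

lemma hausdorff_dist_image_le:
  fixes f g :: "'a::euclidean_space \<Rightarrow> 'a"
  assumes "compact (f ` S)" "compact (g ` S)" "S \<noteq> {}"
    and "\<And>x. x \<in> S \<Longrightarrow> dist (f x) (g x) \<le> e"
  shows "hausdorff_dist (f ` S) (g ` S) \<le> e"
  using assms by (auto simp: hausdorff_dist_le_iff)

section \<open>Isometries of Euclidean space and their sequential compactness\<close>

definition isometric :: "('a::euclidean_space \<Rightarrow> 'a) \<Rightarrow> bool" where
  "isometric g \<longleftrightarrow> bij g \<and> (\<forall>x y. dist (g x) (g y) = dist x y)"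

lemma isometric_ball_image:
  assumes "isometric g"
  shows "g ` ball x r = ball (g x) r"
proof
  show "g ` ball x r \<subseteq> ball (g x) r"
    using assms by (auto simp: isometric_def)
  show "ball (g x) r \<subseteq> g ` ball x r"
  proof
    fix y assume "y \<in> ball (g x) r"
    moreover obtain z where "y = g z"
      using assms by (metis isometric_def bij_pointE)
    ultimately show "y \<in> g ` ball x r"
      using assms by (auto simp: isometric_def)
  qed
qed

lemma isometric_interior_image:
  assumes "isometric g"
  shows "interior (g ` S) = g ` interior S"
proof -
  have inj: "inj g" using assms by (simp add: isometric_def bij_is_inj)
  have "g x \<in> interior (g ` S) \<longleftrightarrow> x \<in> interior S" for x
    unfolding mem_interior isometric_ball_image[OF assms, symmetric]
    by (simp add: inj_image_subset_iff inj)
  moreover have "\<exists>x. y = g x" for y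
    using assms by (metis isometric_def bij_pointE)
  ultimately show ?thesis
    unfolding set_eq_iff image_iff by metis
qed

lemma isometric_continuous_on: "isometric g \<Longrightarrow> continuous_on S g"
  unfolding continuous_on_iff isometric_def by metis

lemma isometric_closure_image:
  assumes "isometric g"
  shows "closure (g ` S) = g ` closure S"
proof -
  have b: "bij g" using assms by (simp add: isometric_def)
  have "g ` (- interior (- S)) = - interior (- g ` S)"
    using b by (simp add: bij_image_Compl_eq flip: isometric_interior_image[OF assms])
  then show ?thesis
    by (simp add: closure_interior)
qed

lemma isometric_translation: "isometric ((+) v)"
  by (auto simp: isometric_def)

text \<open>An isometry that fixes the origin is an orthogonal linear map. The linear part is
  returned as a bounded linear function because these form a finite-dimensional normed space, in
  which the bound 1 yields convergent subsequences.\<close>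

lemma isometric_decompose:
  fixes g :: "'a::euclidean_space \<Rightarrow> 'a"
  assumes "isometric g"
  obtains L :: "'a \<Rightarrow>\<^sub>L 'a" where "\<And>x. g x = g 0 + blinfun_apply L x" "norm L \<le> 1"
proof -
  define f where "f x = g x - g 0" for x
  have "orthogonal_transformation f"
    unfolding orthogonal_transformation_isometry f_def
    using assms by (simp add: isometric_def dist_norm)
  then have lin: "linear f" and n: "\<And>x. norm (f x) = norm x"
    by (simp_all add: orthogonal_transformation)
  then have bl: "bounded_linear f"
    by (simp add: linear_conv_bounded_linear)
  show ?thesis
  proof
    show "g x = g 0 + blinfun_apply (Blinfun f) x" for x
      by (simp add: bounded_linear_Blinfun_apply bl f_def)
    show "norm (Blinfun f) \<le> 1"
      by (rule norm_blinfun_bound) (simp_all add: bounded_linear_Blinfun_apply bl n)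
  qed
qed

text \<open>Closedness of \<open>G\<close> refers to the product topology on functions, whereas
  limits of isometries are found point by point; this connects the two.\<close>

lemma tendsto_fun_iff:
  fixes f :: "'c \<Rightarrow> 'a \<Rightarrow> 'b::topological_space"
  shows "(f \<longlongrightarrow> l) F \<longleftrightarrow> (\<forall>x. ((\<lambda>k. f k x) \<longlongrightarrow> l x) F)"
  using limitin_componentwise[of "\<lambda>_. euclidean" UNIV f l F]
  by (simp add: euclidean_product_topology)

text \<open>Translation parts and linear parts together form a bounded sequence in a
  finite-dimensional space, so Bolzano-Weierstrass applies. Convergence of the linear parts in
  operator norm gives uniformity on bounded sets, which is what Hausdorff distances of images
  require.\<close>

lemma isometric_sequence_compact:
  fixes g :: "nat \<Rightarrow> 'a::euclidean_space \<Rightarrow> 'a"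
  assumes "\<And>k. isometric (g k)" "bounded (range (\<lambda>k. g k 0))"
  obtains r h where "strict_mono (r :: nat \<Rightarrow> nat)" "\<forall>x. (\<lambda>k. g (r k) x) \<longlonglongrightarrow> h x"
    "\<forall>S e. bounded S \<longrightarrow> 0 < e \<longrightarrow> eventually (\<lambda>k. \<forall>x\<in>S. dist (g (r k) x) (h x) \<le> e) sequentially"
proof -
  have "\<exists>M. (\<forall>x. g k x = g k 0 + blinfun_apply M x) \<and> norm M \<le> 1" for k
    using isometric_decompose[OF assms(1)[of k]] by blast
  then obtain L :: "nat \<Rightarrow> 'a \<Rightarrow>\<^sub>L 'a"
    where L: "\<And>k x. g k x = g k 0 + blinfun_apply (L k) x" "\<And>k. norm (L k) \<le> 1"
    by metis
  have "bounded (range (\<lambda>k. (g k 0, L k)))"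
  proof (rule bounded_subset)
    show "bounded (range (\<lambda>k. g k 0) \<times> cball (0 :: 'a \<Rightarrow>\<^sub>L 'a) 1)"
      by (intro bounded_Times assms bounded_cball)
  qed (auto simp: L(2))
  then obtain l r where r: "strict_mono (r :: nat \<Rightarrow> nat)" "((\<lambda>k. (g k 0, L k)) \<circ> r) \<longlonglongrightarrow> l"
    using bounded_imp_convergent_subsequence by blast
  obtain a M where l: "l = (a, M)" by force
  have a: "(\<lambda>k. g (r k) 0) \<longlonglongrightarrow> a" and M: "(\<lambda>k. L (r k)) \<longlonglongrightarrow> M"
    using tendsto_fst[OF r(2)] tendsto_snd[OF r(2)] by (simp_all add: o_def l)
  define h where "h x = a + blinfun_apply M x" for x
  have unif: "eventually (\<lambda>k. \<forall>x\<in>S. dist (g (r k) x) (h x) \<le> e) sequentially"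
    if "bounded S" "0 < e" for S e
  proof -
    obtain B where B: "B > 0" "\<And>x. x \<in> S \<Longrightarrow> norm x \<le> B"
      using \<open>bounded S\<close> bounded_pos by blast
    have "eventually (\<lambda>k. dist (g (r k) 0) a < e / 2) sequentially"
      using tendstoD[OF a, of "e / 2"] that by simp
    moreover have "eventually (\<lambda>k. dist (L (r k)) M < e / (2 * B)) sequentially"
      using tendstoD[OF M, of "e / (2 * B)"] that B by simp
    ultimately show ?thesis
    proof eventually_elim
      case (elim k)
      show ?case
      proof
        fix x assume x: "x \<in> S"
        have "dist (g (r k) x) (h x) = norm ((g (r k) 0 - a) + blinfun_apply (L (r k) - M) x)"
          by (simp add: h_def dist_norm L(1)[of "r k" x] blinfun.diff_left algebra_simps)
        also have "\<dots> \<le> norm (g (r k) 0 - a) + norm (L (r k) - M) * norm x"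
          by (meson norm_triangle_le add_left_mono norm_blinfun)
        also have "\<dots> \<le> e / 2 + (e / (2 * B)) * B"
          using elim B x \<open>0 < e\<close> by (intro add_mono mult_mono) (auto simp: dist_norm)
        also have "\<dots> = e" using B by simp
        finally show "dist (g (r k) x) (h x) \<le> e" .
      qed
    qed
  qed
  have "(\<lambda>k. g (r k) x) \<longlonglongrightarrow> h x" for x
    unfolding tendsto_iff
  proof (intro allI impI)
    fix e :: real assume "0 < e"
    then show "\<forall>\<^sub>F k in sequentially. dist (g (r k) x) (h x) < e"
      using unif[of "{x}" "e / 2"] by (auto elim!: eventually_mono)
  qed
  then show ?thesis using that r(1) unif by blast
qed

section \<open>Packings and the modified Hausdorff distance\<close>

text \<open>Supplies the countably many probes of a later diagonal argument. A finite net of the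
  compact set is moved point by point into \<open>D\<close>.\<close>

lemma approx_by_finite_subset_of_dense:
  fixes A D :: "'a::euclidean_space set"
  assumes "compact A" "A \<noteq> {}" "closure D = UNIV" "0 < e"
  obtains F where "finite F" "F \<subseteq> D" "F \<noteq> {}" "hausdorff_dist A F \<le> e"
proof -
  obtain C where C: "finite C" "C \<subseteq> A" "A \<subseteq> (\<Union>x\<in>C. ball x (e / 2))"
  proof -
    show thesis if "\<And>C. finite C \<Longrightarrow> C \<subseteq> A \<Longrightarrow> A \<subseteq> (\<Union>x\<in>C. ball x (e / 2)) \<Longrightarrow> thesis"
      by (rule compactE_image[OF assms(1), of A "\<lambda>x. ball x (e / 2)"]) (use assms(4) that in auto)
  qed
  have "\<exists>y\<in>D. dist y x < e / 2" for x
    using assms closure_approachable[of x D] by (metis UNIV_I half_gt_zero)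
  then obtain d where d: "\<And>x. d x \<in> D" "\<And>x. dist (d x) x < e / 2"
    by metis
  have ne: "C \<noteq> {}" using C assms by auto
  have "hausdorff_dist A (d ` C) \<le> e"
  proof (subst hausdorff_dist_le_iff)
    show "(\<forall>a\<in>A. \<exists>b\<in>d ` C. dist a b \<le> e) \<and> (\<forall>b\<in>d ` C. \<exists>a\<in>A. dist a b \<le> e)"
    proof (intro conjI ballI)
      fix a assume "a \<in> A"
      then obtain x where "x \<in> C" "dist x a < e / 2" using C by auto
      then show "\<exists>b\<in>d ` C. dist a b \<le> e"
        using d(2)[of x] dist_triangle2[of a "d x" x] dist_commute[of x a]
        by (intro bexI[of _ "d x"]) auto
    next
      fix b assume "b \<in> d ` C"
      then obtain x where "x \<in> C" "b = d x" by auto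
      then show "\<exists>a\<in>A. dist a b \<le> e"
        using d(2)[of x] C assms by (intro bexI[of _ x]) (auto simp: dist_commute)
    qed
  qed (use assms ne C in \<open>auto intro: finite_imp_compact\<close>)
  with that[of "d ` C"] show ?thesis using C ne d by auto
qed

lemma measure_ball_pos: "0 < r \<Longrightarrow> 0 < measure lborel (ball (x::'a::euclidean_space) r)"
  by (simp add: content_ball_pos)

lemma fmeasurable_ball: "ball (p::'a::euclidean_space) r \<in> fmeasurable lborel"
  by (intro fmeasurableI) (simp_all add: emeasure_lborel_ball_finite flip: infinity_ennreal_def)

text \<open>The uniqueness clauses of \<open>mod_hausdorff_le\<close> are dropped here: for small distances they are
  automatic, since distinct elements of a packing are at least an inradius of \<open>K\<close> apart.\<close>

definition near :: "real \<Rightarrow> 'a::euclidean_space set set \<Rightarrow> 'a set set \<Rightarrow> bool" where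
  "near e P Q \<longleftrightarrow>
     (\<forall>A\<in>P. A \<subseteq> cball 0 (1 / e) \<longrightarrow> (\<exists>B\<in>Q. hausdorff_dist A B \<le> e)) \<and>
     (\<forall>B\<in>Q. B \<subseteq> cball 0 (1 / e) \<longrightarrow> (\<exists>A\<in>P. hausdorff_dist A B \<le> e))"

text \<open>For packings this agrees with \<open>packings_converge\<close>, but there is no matching
  relation to carry through each argument.\<close>

definition converges :: "(nat \<Rightarrow> 'a::euclidean_space set set) \<Rightarrow> 'a set set \<Rightarrow> bool" where
  "converges X Q \<longleftrightarrow> (\<forall>e>0. eventually (\<lambda>k. near e (X k) Q) sequentially)"

lemma near_sym: "near e P Q \<Longrightarrow> near e Q P"
  unfolding near_def by (metis hausdorff_dist_commute)

lemma near_Un: "near e P Q \<Longrightarrow> near e P' Q' \<Longrightarrow> near e (P \<union> P') (Q \<union> Q')"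
  unfolding near_def by blast

lemma cball_inverse_mono:
  fixes e d :: real
  assumes "0 < d" "d \<le> e"
  shows "cball (0::'a::euclidean_space) (1 / e) \<subseteq> cball 0 (1 / d)"
  using assms by (simp add: frac_le subset_cball)

lemma near_mono: "near d P Q \<Longrightarrow> 0 < d \<Longrightarrow> d \<le> e \<Longrightarrow> near e P Q"
  unfolding near_def using cball_inverse_mono[of d e] by (meson order_trans)

lemma mod_hausdorff_le_imp_near: "mod_hausdorff_le P Q e \<Longrightarrow> near e P Q"
  unfolding near_def mod_hausdorff_le_def by metis

lemma converges_subseq: "converges X Q \<Longrightarrow> strict_mono r \<Longrightarrow> converges (X \<circ> r) Q"
  using eventually_subseq[of r "\<lambda>k. near e (X k) Q" for e] by (simp add: converges_def)

lemma converges_Un: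
  "converges X P \<Longrightarrow> converges Y Q \<Longrightarrow> converges (\<lambda>k. X k \<union> Y k) (P \<union> Q)"
  unfolding converges_def
proof (intro allI impI)
  fix e :: real
  assume e: "0 < e" and "\<forall>e>0. eventually (\<lambda>k. near e (X k) P) sequentially"
    and "\<forall>e>0. eventually (\<lambda>k. near e (Y k) Q) sequentially"
  then have "eventually (\<lambda>k. near e (X k) P) sequentially" "eventually (\<lambda>k. near e (Y k) Q) sequentially"
    by simp_all
  then show "eventually (\<lambda>k. near e (X k \<union> Y k) (P \<union> Q)) sequentially"
    by eventually_elim (rule near_Un)
qed

section \<open>Copies of \<open>K\<close>: separation, compactness and stability of
  interiors\<close>

locale packing_space =
  fixes G :: "('a::euclidean_space \<Rightarrow> 'a) set" and K :: "'a set"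
  assumes allowed: "allowed_isometry_group G"
    and closed_G: "closed G"
    and body_K: "body K"
begin

lemma isometric_G: "g \<in> G \<Longrightarrow> isometric g"
  using allowed by (simp add: allowed_isometry_group_def isometry_group_def isometric_def)

lemma compact_K: "compact K" and K_nonempty: "K \<noteq> {}" and K_eq: "closure (interior K) = K"
  using body_K by (auto simp: body_def domain_def)

lemma copyE:
  assumes "A \<in> copies G K"
  obtains g where "g \<in> G" "isometric g" "A = g ` K"
  using assms isometric_G by (auto simp: copies_def)

lemma copy_compact: "A \<in> copies G K \<Longrightarrow> compact A"
  by (metis copyE compact_K compact_continuous_image isometric_continuous_on)

lemma copy_nonempty: "A \<in> copies G K \<Longrightarrow> A \<noteq> {}"
  using K_nonempty by (auto simp: copies_def)

lemma copy_eq: "A \<in> copies G K \<Longrightarrow> closure (interior A) = A"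
  by (auto elim!: copyE simp: K_eq isometric_interior_image isometric_closure_image)

lemma copy_translate: "A \<in> copies G K \<Longrightarrow> (+) v ` A \<in> copies G K"
proof -
  assume "A \<in> copies G K"
  then obtain g where "g \<in> G" "A = g ` K" by (metis copyE)
  moreover from this have "(+) v \<circ> g \<in> G"
    using allowed by (simp add: allowed_isometry_group_def isometry_group_def)
  ultimately show ?thesis
    unfolding copies_def by (auto simp: image_comp intro!: exI[of _ "(+) v \<circ> g"])
qed

text \<open>Not the largest inscribed radius. Any fixed positive one serves, both as separation
  constant for packings and as a lower bound for volumes.\<close>

definition inradius :: real where
  "inradius = (SOME r. 0 < r \<and> (\<exists>x. ball x r \<subseteq> K))"

lemma inradius: "0 < inradius" "\<exists>x. ball x inradius \<subseteq> K"
proof -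
  have "interior K \<noteq> {}" using K_eq K_nonempty by auto
  then have "\<exists>r. 0 < r \<and> (\<exists>x. ball x r \<subseteq> K)"
    by (metis equals0I mem_interior)
  from someI_ex[OF this] show "0 < inradius" "\<exists>x. ball x inradius \<subseteq> K"
    unfolding inradius_def by auto
qed

lemma copy_inradius:
  assumes "A \<in> copies G K"
  obtains x where "ball x inradius \<subseteq> A"
proof -
  obtain g where g: "isometric g" "A = g ` K" using assms copyE by metis
  obtain x where "ball x inradius \<subseteq> K" using inradius by blast
  then have "ball (g x) inradius \<subseteq> A"
    using isometric_ball_image[OF g(1), of x inradius] g(2) by blast
  with that show ?thesis .
qed

lemma copy_diameter: "A \<in> copies G K \<Longrightarrow> x \<in> A \<Longrightarrow> y \<in> A \<Longrightarrow> dist x y \<le> diameter K"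
  by (auto elim!: copyE simp: isometric_def compact_K compact_imp_bounded diameter_bounded_bound)

lemma copy_subset_ball:
  assumes "A \<in> copies G K"
  obtains r where "A \<subseteq> cball 0 r"
  using bounded_subset_ballD[OF compact_imp_bounded[OF copy_compact[OF assms]], of 0]
    ball_subset_cball by blast

lemma hd_triangle:
  assumes "A \<in> copies G K" "B \<in> copies G K" "C \<in> copies G K"
    "hausdorff_dist A B \<le> d" "hausdorff_dist B C \<le> e"
  shows "hausdorff_dist A C \<le> d + e"
  using hausdorff_dist_triangle_le[of A B C d e] assms copy_compact copy_nonempty by blast

lemma hd_ball:
  assumes "A \<in> copies G K" "B \<in> copies G K" "hausdorff_dist A B \<le> e" "A \<subseteq> cball 0 r" "r + e \<le> s"
  shows "B \<subseteq> cball 0 s"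
  using hausdorff_dist_subset_cball[of A B e r s] assms copy_compact copy_nonempty by blast

lemma hd_self: "A \<in> copies G K \<Longrightarrow> 0 \<le> e \<Longrightarrow> hausdorff_dist A A \<le> e"
  using hausdorff_dist_self_le copy_compact copy_nonempty by blast

lemma packing_copies: "packing G K P \<Longrightarrow> A \<in> P \<Longrightarrow> A \<in> copies G K"
  by (auto simp: packing_def)

lemma packing_subset: "packing G K P \<Longrightarrow> Q \<subseteq> P \<Longrightarrow> packing G K Q"
  unfolding packing_def by (auto elim: pairwise_subset)

lemma packing_disjoint:
  "packing G K P \<Longrightarrow> A \<in> P \<Longrightarrow> B \<in> P \<Longrightarrow> x \<in> interior A \<Longrightarrow> x \<in> interior B \<Longrightarrow> A = B"
  unfolding packing_def pairwise_def by (metis IntI empty_iff)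

text \<open>A ball of radius \<open>inradius\<close> inside \<open>A\<close> is centred at a point
  of \<open>A\<close>, so \<open>B\<close> has a point in that ball. As \<open>B\<close> is the
  closure of its interior, its interior meets the ball too, and the interiors of \<open>A\<close>
  and \<open>B\<close> overlap.\<close>

lemma packing_separated:
  assumes "packing G K P" "A \<in> P" "B \<in> P" "hausdorff_dist A B < inradius"
  shows "A = B"
proof -
  have AB: "A \<in> copies G K" "B \<in> copies G K" using assms packing_copies by auto
  obtain a where a: "ball a inradius \<subseteq> A" using copy_inradius AB by metis
  then have "a \<in> A" using inradius by auto
  moreover have "\<forall>a\<in>A. \<exists>b\<in>B. dist a b \<le> hausdorff_dist A B"
    using hausdorff_dist_le_iff[of A B "hausdorff_dist A B"] AB copy_compact copy_nonempty by blast
  ultimately obtain b where b: "b \<in> B" "b \<in> ball a inradius"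
    using assms(4) by fastforce
  then have "ball a inradius \<inter> interior B \<noteq> {}"
    using open_Int_closure_eq_empty[of "ball a inradius" "interior B"] copy_eq AB by auto
  moreover have "ball a inradius \<subseteq> interior A" using a by (simp add: interior_maximal)
  ultimately show ?thesis
    using packing_disjoint[OF assms(1-3)] by blast
qed

text \<open>The copies are turned into isometries, whose values at the origin stay bounded; the
  limit isometry belongs to \<open>G\<close> because \<open>G\<close> is closed. The isometries are
  returned next to the copies because interiors have to be followed through moving points, not
  through Hausdorff distance.\<close>

lemma copies_sequence_compact:
  assumes "\<And>k. A k \<in> copies G K" "\<And>k. A k \<subseteq> cball 0 R"
  obtains r g h where "strict_mono (r :: nat \<Rightarrow> nat)" "\<forall>k. g k \<in> G" "\<forall>k. A (r k) = g k ` K" "h \<in> G"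
    "\<forall>x. (\<lambda>k. g k x) \<longlonglongrightarrow> h x"
    "\<forall>e>0. eventually (\<lambda>k. hausdorff_dist (A (r k)) (h ` K) \<le> e) sequentially"
proof -
  obtain f where f: "\<And>k. f k \<in> G" "\<And>k. A k = f k ` K"
  proof -
    have "\<exists>g. g \<in> G \<and> A k = g ` K" for k
      using assms(1)[of k] by (auto simp: copies_def)
    then show thesis using that by metis
  qed
  obtain z where z: "z \<in> K" using K_nonempty by blast
  have "dist 0 (f k 0) \<le> R + dist z 0" for k
  proof -
    have "f k z \<in> cball 0 R" using f z assms(2) by blast
    moreover have "dist (f k z) (f k 0) = dist z 0"
      using isometric_G[OF f(1)] by (simp add: isometric_def)
    ultimately show ?thesis using dist_triangle[of 0 "f k 0" "f k z"] by (simp add: dist_commute)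
  qed
  then have "bounded (range (\<lambda>k. f k 0))"
    unfolding bounded_def by blast
  then obtain r h where r: "strict_mono (r :: nat \<Rightarrow> nat)"
    and lim: "\<forall>x. (\<lambda>k. f (r k) x) \<longlonglongrightarrow> h x"
    and unif: "\<forall>S e. bounded S \<longrightarrow> 0 < e \<longrightarrow>
        eventually (\<lambda>k. \<forall>x\<in>S. dist (f (r k) x) (h x) \<le> e) sequentially"
    by (rule isometric_sequence_compact[OF isometric_G[OF f(1)]]) (rule that)
  have "(\<lambda>k. f (r k)) \<longlonglongrightarrow> h"
    using lim by (simp add: tendsto_fun_iff)
  then have h: "h \<in> G"
    using closed_sequentially[OF closed_G] f(1) by metis
  have "eventually (\<lambda>k. hausdorff_dist (A (r k)) (h ` K) \<le> e) sequentially" if "0 < e" for e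
    using unif[rule_format, OF compact_imp_bounded[OF compact_K] that]
  proof eventually_elim
    case (elim k)
    then show ?case
      unfolding f(2)
      by (intro hausdorff_dist_image_le compact_continuous_image isometric_continuous_on isometric_G
          compact_K K_nonempty f h) auto
  qed
  with that[of r "\<lambda>k. f (r k)" h] r f h lim show ?thesis by blast
qed

text \<open>For arbitrary compact sets this fails, since finite sets approximate all of them; for
  copies it is a compactness argument. Copies that tend to \<open>A\<close> without having
  \<open>x\<close> in their interior yield isometries \<open>g k\<close> with limit
  \<open>h\<close>. A ball about the preimage of \<open>x\<close> under \<open>h\<close> is carried
  by \<open>g k\<close> to a ball of the same radius about a point near \<open>x\<close>.\<close>

lemma interior_stable:
  assumes "A \<in> copies G K" "x \<in> interior A"
  obtains e where "0 < e" "\<And>B. B \<in> copies G K \<Longrightarrow> hausdorff_dist A B \<le> e \<Longrightarrow> x \<in> interior B"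
proof (rule ccontr)
  note obtained = that
  assume "\<not> thesis"
  then have "\<exists>B. B \<in> copies G K \<and> hausdorff_dist A B \<le> e \<and> x \<notin> interior B" if "0 < e" for e
    using obtained[OF that] \<open>\<not> thesis\<close> by auto
  then have "\<exists>B. B \<in> copies G K \<and> hausdorff_dist A B \<le> inverse (real (Suc k)) \<and> x \<notin> interior B" for k
    by simp
  then obtain B where B: "\<And>k. B k \<in> copies G K" "\<And>k. x \<notin> interior (B k)"
    "\<And>k. hausdorff_dist A (B k) \<le> inverse (real (Suc k))"
    by metis
  obtain R where R: "A \<subseteq> cball 0 R" using copy_subset_ball assms by metis
  have BR: "B k \<subseteq> cball 0 (R + 1)" for k
    by (rule hd_ball[OF assms(1) B(1) B(3) R]) (simp add: field_simps)
  obtain r g h where r: "strict_mono (r :: nat \<Rightarrow> nat)" "\<forall>k. g k \<in> G" "\<forall>k. B (r k) = g k ` K"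
    and h: "h \<in> G" "\<forall>x. (\<lambda>k. g k x) \<longlonglongrightarrow> h x"
    "\<forall>e>0. eventually (\<lambda>k. hausdorff_dist (B (r k)) (h ` K) \<le> e) sequentially"
    by (rule copies_sequence_compact[OF B(1) BR]) (rule that)
  have hK: "h ` K \<in> copies G K" using h by (auto simp: copies_def)
  \<comment> \<open>Both sets are Hausdorff limits of the same sequence of copies.\<close>
  have "A = h ` K"
  proof (rule hausdorff_dist_eqI)
    fix e :: real assume "0 < e"
    then have "eventually (\<lambda>k. hausdorff_dist (B (r k)) (h ` K) \<le> e / 2) sequentially"
      using h(3)[rule_format, of "e / 2"] by simp
    moreover have "eventually (\<lambda>k. inverse (real (Suc k)) < e / 2) sequentially"
      using LIMSEQ_inverse_real_of_nat \<open>0 < e\<close> by (metis half_gt_zero order_tendstoD(2))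
    ultimately have "eventually (\<lambda>k. hausdorff_dist A (h ` K) \<le> e) sequentially"
    proof eventually_elim
      case (elim k)
      have "inverse (real (Suc (r k))) \<le> inverse (real (Suc k))"
        using seq_suble[OF r(1), of k] by (simp add: field_simps)
      with elim B(3)[of "r k"] have "hausdorff_dist A (B (r k)) \<le> e / 2" by linarith
      then show ?case
        using hd_triangle[OF assms(1) B(1) hK _ elim(1), of "e / 2"] by simp
    qed
    then show "hausdorff_dist A (h ` K) \<le> e"
      by simp
  qed (use assms hK copy_compact copy_nonempty in auto)
  then obtain y where y: "y \<in> interior K" "x = h y"
    using assms(2) isometric_interior_image[OF isometric_G[OF h(1)]] by auto
  then obtain d where d: "0 < d" "ball y d \<subseteq> K" by (metis mem_interior)
  have "eventually (\<lambda>k. dist (g k y) (h y) < d) sequentially"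
    using h(2) d tendstoD by blast
  then obtain k where "dist (g k y) (h y) < d"
    by (auto simp: eventually_sequentially)
  moreover have "ball (g k y) d \<subseteq> interior (B (r k))"
    using isometric_ball_image[OF isometric_G[OF r(2)[rule_format, of k]], of y d]
      image_mono[OF d(2), of "g k"] r(3)
    by (intro interior_maximal) simp_all
  ultimately show False
    using B(2)[of "r k"] y by auto
qed

text \<open>A point interior to both \<open>A\<close> and \<open>B\<close> would be interior to
  their approximants in \<open>X k\<close>; these are then one element, which forces
  \<open>A = B\<close>. Only elements of \<open>Q\<close> have to be approximated, so the lemma
  applies before any convergence is known.\<close>

lemma packing_limit:
  assumes "\<And>k. packing G K (X k)" "Q \<subseteq> copies G K"
    and "\<And>A e. A \<in> Q \<Longrightarrow> 0 < e \<Longrightarrow> eventually (\<lambda>k. \<exists>B\<in>X k. hausdorff_dist A B \<le> e) sequentially"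
  shows "packing G K Q"
  unfolding packing_def
proof (intro conjI pairwiseI)
  fix A B assume AB: "A \<in> Q" "B \<in> Q" "A \<noteq> B"
  then have c: "A \<in> copies G K" "B \<in> copies G K" using assms by auto
  show "interior A \<inter> interior B = {}"
  proof (rule ccontr)
    assume "interior A \<inter> interior B \<noteq> {}"
    then obtain x where x: "x \<in> interior A" "x \<in> interior B" by auto
    obtain d where d: "0 < d" "\<And>C. C \<in> copies G K \<Longrightarrow> hausdorff_dist A C \<le> d \<Longrightarrow> x \<in> interior C"
      using interior_stable[OF c(1) x(1)] by metis
    obtain d' where d': "0 < d'" "\<And>C. C \<in> copies G K \<Longrightarrow> hausdorff_dist B C \<le> d' \<Longrightarrow> x \<in> interior C"
      using interior_stable[OF c(2) x(2)] by metis
    have "A = B"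
    proof (rule hausdorff_dist_eqI)
      fix e :: real assume "0 < e"
      define q where "q = min (e / 2) (min d d')"
      have "0 < q" using d d' \<open>0 < e\<close> by (simp add: q_def)
      then have "eventually (\<lambda>k. (\<exists>C\<in>X k. hausdorff_dist A C \<le> q) \<and> (\<exists>C\<in>X k. hausdorff_dist B C \<le> q)) sequentially"
        using assms(3) AB by (simp add: eventually_conj_iff)
      then obtain k C C' where C: "C \<in> X k" "hausdorff_dist A C \<le> q" "C' \<in> X k" "hausdorff_dist B C' \<le> q"
        by (auto simp: eventually_sequentially)
      then have cc: "C \<in> copies G K" "C' \<in> copies G K" using packing_copies assms by auto
      then have "x \<in> interior C" "x \<in> interior C'"
        using C d d' by (auto simp: q_def)
      then have "C = C'" using packing_disjoint assms(1) C by metis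
      then have "hausdorff_dist A B \<le> q + q"
        using hd_triangle c cc C hausdorff_dist_commute by metis
      then show "hausdorff_dist A B \<le> e" by (simp add: q_def)
    qed (use c copy_compact copy_nonempty in auto)
    with AB show False by simp
  qed
qed (fact assms)

text \<open>Each element contains a ball of radius \<open>inradius\<close>, and these balls are
  disjoint because they lie in the interiors.\<close>

lemma packing_card_bound:
  assumes "packing G K P" "finite P" "\<And>A. A \<in> P \<Longrightarrow> A \<subseteq> ball p r"
  shows "real (card P) * measure lborel (ball (0::'a) inradius) \<le> measure lborel (ball p r)"
proof -
  have "\<exists>x. ball x inradius \<subseteq> A" if "A \<in> P" for A
    using copy_inradius packing_copies[OF assms(1) that] by metis
  then obtain x where x: "\<And>A. A \<in> P \<Longrightarrow> ball (x A) inradius \<subseteq> A" by metis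
  then have xi: "ball (x A) inradius \<subseteq> interior A" if "A \<in> P" for A
    using that by (simp add: interior_maximal)
  have "real (card P) * measure lborel (ball (0::'a) inradius)
      = (\<Sum>A\<in>P. measure lborel (ball (x A) inradius))"
    using inradius by (simp add: content_ball)
  also have "\<dots> = measure lborel (\<Union>A\<in>P. ball (x A) inradius)"
  proof (rule measure_finite_Union[symmetric])
    show "disjoint_family_on (\<lambda>A. ball (x A) inradius) P"
      unfolding disjoint_family_on_def
      using xi packing_disjoint[OF assms(1)] by blast
  qed (use assms emeasure_lborel_ball_finite in \<open>auto simp: less_top\<close>)
  also have "\<dots> \<le> measure lborel (ball p r)"
    by (rule measure_mono_fmeasurable)
      (use x assms(2,3) in \<open>blast, auto intro!: sets.finite_UN fmeasurable_ball\<close>)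
  finally show ?thesis .
qed

text \<open>The bound for finite packings applies to every finite subset, and a common bound on
  their cardinalities makes the whole set finite.\<close>

lemma packing_locally_finite:
  assumes "packing G K P" "\<And>A. A \<in> P \<Longrightarrow> A \<subseteq> ball p r"
  shows "finite P" "real (card P) * measure lborel (ball (0::'a) inradius) \<le> measure lborel (ball p r)"
proof -
  define v where "v = measure lborel (ball (0::'a) inradius)"
  have v: "0 < v" using inradius by (simp add: v_def measure_ball_pos)
  have "card F \<le> nat \<lceil>measure lborel (ball p r) / v\<rceil>" if "F \<subseteq> P" "finite F" for F
  proof -
    have "real (card F) * v \<le> measure lborel (ball p r)"
      unfolding v_def using packing_card_bound packing_subset assms that by blast
    then have "real (card F) \<le> measure lborel (ball p r) / v"
      using v by (simp add: field_simps)
    then show ?thesis by linarith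
  qed
  then show "finite P" by (meson finite_if_finite_subsets_card_bdd)
  then show "real (card P) * measure lborel (ball (0::'a) inradius) \<le> measure lborel (ball p r)"
    using packing_card_bound assms by blast
qed

lemma packing_finite_cball:
  assumes "packing G K P"
  shows "finite {A \<in> P. A \<subseteq> cball 0 r}"
proof (rule packing_locally_finite(1))
  show "packing G K {A \<in> P. A \<subseteq> cball 0 r}" by (rule packing_subset[OF assms]) auto
  show "A \<subseteq> ball 0 (r + 1)" if "A \<in> {A \<in> P. A \<subseteq> cball 0 r}" for A
    using that cball_subset_ball_iff[of "0::'a" r 0 "r + 1"] by auto
qed

end

section \<open>Translates and convergence of packings\<close>

lemma hausdorff_dist_translate_le:
  fixes A B :: "'a::euclidean_space set"
  assumes "compact A" "compact B" "A \<noteq> {}" "B \<noteq> {}" "hausdorff_dist A B \<le> e"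
  shows "hausdorff_dist ((+) v ` A) ((+) v ` B) \<le> e"
  using assms by (simp add: hausdorff_dist_le_iff compact_translation)

lemma translate_0 [simp]: "translate 0 P = P"
  by (simp add: translate_def)

lemma translate_translate [simp]: "translate v (translate w P) = translate (v + w) P"
  by (simp add: translate_def image_image add.assoc)

lemma translate_interior:
  fixes v :: "'a::euclidean_space"
  shows "interior ((+) v ` A) = (+) v ` interior A"
  by (rule isometric_interior_image[OF isometric_translation])

lemma translation_subset_cball:
  fixes v :: "'a::euclidean_space"
  shows "(+) v ` A \<subseteq> cball 0 r \<Longrightarrow> r + norm v \<le> s \<Longrightarrow> A \<subseteq> cball 0 s"
proof
  fix x assume "(+) v ` A \<subseteq> cball 0 r" "r + norm v \<le> s" "x \<in> A"
  then have "norm (v + x) \<le> r" by auto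
  then show "x \<in> cball 0 s"
    using norm_triangle_ineq4[of "v + x" v] \<open>r + norm v \<le> s\<close> by simp
qed

context packing_space
begin

lemma packing_translate: "packing G K P \<Longrightarrow> packing G K (translate v P)"
  unfolding packing_def
proof (intro conjI pairwiseI)
  assume P: "P \<subseteq> copies G K \<and> pairwise (\<lambda>A B. interior A \<inter> interior B = {}) P"
  then show "translate v P \<subseteq> copies G K" by (auto simp: translate_def intro!: copy_translate)
  fix A B assume "A \<in> translate v P" "B \<in> translate v P" "A \<noteq> B"
  then obtain A' B' where "A' \<in> P" "B' \<in> P" "A' \<noteq> B'" "A = (+) v ` A'" "B = (+) v ` B'"
    by (auto simp: translate_def)
  moreover from this P have "interior A' \<inter> interior B' = {}"
    by (auto simp: pairwise_def)
  ultimately show "interior A \<inter> interior B = {}"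
    by (auto simp: translate_interior)
qed

lemma near_trans:
  assumes P: "P \<subseteq> copies G K" and Q: "Q \<subseteq> copies G K" and R: "R \<subseteq> copies G K"
    and "near e P Q" "near e Q R" "0 < e" "e \<le> 1 / 2"
  shows "near (2 * e) P R"
proof -
  have *: "\<exists>C\<in>R. hausdorff_dist A C \<le> 2 * e"
    if h: "near e P Q" "near e Q R" "A \<in> P" "A \<subseteq> cball 0 (1 / (2 * e))"
      "P \<subseteq> copies G K" "Q \<subseteq> copies G K" "R \<subseteq> copies G K" for A P Q R
  proof -
    have "A \<subseteq> cball 0 (1 / e)"
      using h(4) cball_inverse_mono[of e "2 * e"] \<open>0 < e\<close> by auto
    then obtain B where B: "B \<in> Q" "hausdorff_dist A B \<le> e"
      using h by (auto simp: near_def)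
    \<comment> \<open>Here \<open>e \<le> 1 / 2\<close> enters: a partner of an element in the ball
      of radius \<open>1 / (2 * e)\<close> still lies in the ball of radius \<open>1 / e\<close>,
      where the second closeness relation applies.\<close>
    have "e * e \<le> (1 / 2) * 1"
      using assms by (intro mult_mono) auto
    then have "1 / (2 * e) + e \<le> 1 / e"
      using \<open>0 < e\<close> by (simp add: field_simps)
    then have "B \<subseteq> cball 0 (1 / e)"
      using hd_ball[of A B e "1 / (2 * e)" "1 / e"] h B by auto
    then obtain C where C: "C \<in> R" "hausdorff_dist B C \<le> e"
      using h B by (auto simp: near_def)
    show ?thesis
      using hd_triangle[of A B C e e] B C h by (intro bexI[of _ C]) auto
  qed
  have "\<exists>C\<in>P. hausdorff_dist C A \<le> 2 * e" if "A \<in> R" "A \<subseteq> cball 0 (1 / (2 * e))" for A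
    using *[OF near_sym[OF assms(5)] near_sym[OF assms(4)] that R Q P]
    by (simp add: hausdorff_dist_commute)
  then show ?thesis
    using *[OF assms(4,5) _ _ P Q R] by (auto simp: near_def)
qed

text \<open>Elements seen in the ball of radius \<open>1 / e\<close> after the translation lie in
  the ball of radius \<open>1 / e + norm v\<close> before it, so closeness is required at a scale
  \<open>d\<close> that sees that far.\<close>

lemma near_translate:
  assumes P: "P \<subseteq> copies G K" and Q: "Q \<subseteq> copies G K" and n: "near d P Q" "0 < d" "d \<le> e"
    "1 / e + norm v \<le> 1 / d"
  shows "near e (translate v P) (translate v Q)"
proof -
  have *: "\<exists>B\<in>translate v Q. hausdorff_dist A B \<le> e"
    if h: "near d P Q" "A \<in> translate v P" "A \<subseteq> cball 0 (1 / e)"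
      "P \<subseteq> copies G K" "Q \<subseteq> copies G K" for A P Q
  proof -
    obtain A' where A': "A' \<in> P" "A = (+) v ` A'" using h by (auto simp: translate_def)
    then have "A' \<subseteq> cball 0 (1 / d)" using h n translation_subset_cball by blast
    then obtain B' where B': "B' \<in> Q" "hausdorff_dist A' B' \<le> d"
      using h A' by (auto simp: near_def)
    then have "hausdorff_dist ((+) v ` A') ((+) v ` B') \<le> d"
      using A' h by (intro hausdorff_dist_translate_le) (auto simp: copy_compact dest: copy_nonempty)
    with B' A' n show ?thesis by (force simp: translate_def)
  qed
  have "\<exists>C\<in>translate v P. hausdorff_dist C A \<le> e" if "A \<in> translate v Q" "A \<subseteq> cball 0 (1 / e)" for A
    using *[OF near_sym[OF n(1)] that Q P] by (simp add: hausdorff_dist_commute)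
  then show ?thesis
    using *[OF n(1) _ _ P Q] by (auto simp: near_def)
qed

lemma converges_imp_packings_converge:
  assumes X: "\<And>k. packing G K (X k)" and Q: "packing G K Q" and "converges X Q"
  shows "packings_converge X Q"
  unfolding packings_converge_def
proof (intro allI impI)
  fix e :: real assume "0 < e"
  \<comment> \<open>Two partners of one element would be within \<open>2 * d\<close> of each other,
    which is below \<open>inradius\<close>. Hence being within \<open>d\<close> is a relation with
    the unique partners that \<open>mod_hausdorff_le\<close> asks for.\<close>
  define d where "d = min e (inradius / 3)"
  have d: "0 < d" "d \<le> e" "d + d < inradius" using inradius \<open>0 < e\<close> by (auto simp: d_def)
  have uniq: "B = C" if h: "packing G K P" "B \<in> P" "C \<in> P" "A \<in> copies G K"
      "hausdorff_dist A B \<le> d" "hausdorff_dist A C \<le> d" for A B C P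
  proof (rule packing_separated[OF h(1-3)])
    have "hausdorff_dist B C \<le> d + d"
      using hd_triangle[OF _ h(4) _ _ h(6), of B d] h(5) packing_copies[OF h(1)] h(2,3)
        hausdorff_dist_commute[of A B] by simp
    then show "hausdorff_dist B C < inradius" using d by simp
  qed
  have "mod_hausdorff_le (X k) Q e" if "near d (X k) Q" for k
    unfolding mod_hausdorff_le_def
  proof (intro exI[of _ "\<lambda>A B. hausdorff_dist A B \<le> d"] conjI ballI impI)
    fix A assume A: "A \<in> X k" "A \<subseteq> cball 0 (1 / e)"
    then have "A \<subseteq> cball 0 (1 / d)" using cball_inverse_mono[of d e] d by auto
    then show "\<exists>!B. B \<in> Q \<and> hausdorff_dist A B \<le> d"
      using that A uniq[OF Q _ _ packing_copies[OF X A(1)]] unfolding near_def by metis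
  next
    fix B assume B: "B \<in> Q" "B \<subseteq> cball 0 (1 / e)"
    then have "B \<subseteq> cball 0 (1 / d)" using cball_inverse_mono[of d e] d by auto
    then show "\<exists>!A. A \<in> X k \<and> hausdorff_dist A B \<le> d"
      using that B uniq[OF X _ _ packing_copies[OF Q B(1)], of _ k] unfolding near_def
      by (metis hausdorff_dist_commute)
  qed (use d in auto)
  then show "eventually (\<lambda>k. mod_hausdorff_le (X k) Q e) sequentially"
    using assms(3) d(1) unfolding converges_def by (blast intro: eventually_mono)
qed

lemma packings_converge_imp_converges: "packings_converge X Q \<Longrightarrow> converges X Q"
  unfolding converges_def packings_converge_def
proof (intro allI impI)
  fix e :: real assume "\<forall>e>0. eventually (\<lambda>k. mod_hausdorff_le (X k) Q e) sequentially" "0 < e"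
  then have "eventually (\<lambda>k. mod_hausdorff_le (X k) Q e) sequentially" by simp
  then show "eventually (\<lambda>k. near e (X k) Q) sequentially"
    by eventually_elim (rule mod_hausdorff_le_imp_near)
qed

lemma limit_ofI:
  assumes "packing G K P" "packing G K Q" "converges (\<lambda>k. translate (t k) P) Q"
  shows "limit_of Q P"
  unfolding limit_of_def
  by (intro exI[of _ t] converges_imp_packings_converge packing_translate assms)

lemma converges_memD:
  assumes "converges X Q" "A \<in> Q" "A \<in> copies G K" "0 < e"
  shows "eventually (\<lambda>k. \<exists>B\<in>X k. hausdorff_dist A B \<le> e) sequentially"
proof -
  obtain R where R: "A \<subseteq> cball 0 R" using assms copy_subset_ball by metis
  \<comment> \<open>With this choice \<open>1 / d\<close> is at least \<open>R\<close>, so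
    \<open>A\<close> itself lies in the ball in which closeness at scale \<open>d\<close> says
    something.\<close>
  define d where "d = min e (1 / (\<bar>R\<bar> + 1))"
  have d: "0 < d" "d \<le> e" "R \<le> 1 / d"
  proof -
    show "0 < d" "d \<le> e" using assms(4) by (auto simp: d_def)
    have "\<bar>R\<bar> + 1 \<le> 1 / d" using \<open>0 < d\<close> by (simp add: d_def min_def field_simps)
    then show "R \<le> 1 / d" by linarith
  qed
  then have "eventually (\<lambda>k. near d (X k) Q) sequentially"
    using assms by (simp add: converges_def)
  then show ?thesis
  proof eventually_elim
    case (elim k)
    have "A \<subseteq> cball 0 (1 / d)" using R d by auto
    then obtain B where "B \<in> X k" "hausdorff_dist B A \<le> d"
      using elim assms by (auto simp: near_def)
    then show ?case using d hausdorff_dist_commute[of A B] by force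
  qed
qed

lemma converges_memI:
  assumes "\<And>k. packing G K (X k)" "packing G K Q" "converges X Q" "A \<in> copies G K"
    and freq: "\<And>e. 0 < e \<Longrightarrow> eventually (\<lambda>k. \<exists>B\<in>X k. hausdorff_dist A B \<le> e) sequentially"
  shows "A \<in> Q"
proof -
  obtain R where R: "A \<subseteq> cball 0 R" using assms copy_subset_ball by metis
  have *: "\<exists>C\<in>Q. hausdorff_dist A C \<le> e" if "0 < e" for e
  proof -
    define d where "d = min (e / 2) (1 / (\<bar>R\<bar> + 1))"
    have d: "0 < d" "d \<le> e / 2" "d \<le> 1 / (\<bar>R\<bar> + 1)"
      using \<open>0 < e\<close> by (auto simp: d_def)
    have "1 / (\<bar>R\<bar> + 1) \<le> 1" by simp
    then have "d \<le> 1" using d by linarith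
    have "\<bar>R\<bar> + 1 \<le> 1 / d" using d by (simp add: field_simps)
    then have dR: "R + d \<le> 1 / d" using \<open>d \<le> 1\<close> by linarith
    have "eventually (\<lambda>k. near d (X k) Q \<and> (\<exists>B\<in>X k. hausdorff_dist A B \<le> d)) sequentially"
      using assms(3) freq d(1) by (simp add: converges_def eventually_conj_iff)
    then obtain k B where B: "near d (X k) Q" "B \<in> X k" "hausdorff_dist A B \<le> d"
      by (auto simp: eventually_sequentially)
    have cB: "B \<in> copies G K" using B assms packing_copies by blast
    then have "B \<subseteq> cball 0 (1 / d)" using hd_ball[OF assms(4) cB B(3) R dR] by simp
    then obtain C where C: "C \<in> Q" "hausdorff_dist B C \<le> d"
      using B by (auto simp: near_def)
    then have "hausdorff_dist A C \<le> d + d"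
      using hd_triangle[OF assms(4) cB _ B(3) C(2)] packing_copies assms(2) by blast
    with C d show ?thesis by (intro bexI[of _ C]) auto
  qed
  \<comment> \<open>The elements of \<open>Q\<close> near \<open>A\<close> at smaller scales
    coincide with this one, since \<open>Q\<close> is separated; so one \<open>C\<close> serves
    every scale.\<close>
  then obtain C where C: "C \<in> Q" "hausdorff_dist A C \<le> inradius / 3"
    using *[of "inradius / 3"] inradius(1) by auto
  have "hausdorff_dist A C \<le> e" if "0 < e" for e
  proof -
    obtain C' where C': "C' \<in> Q" "hausdorff_dist A C' \<le> min e (inradius / 3)"
      using *[of "min e (inradius / 3)"] inradius \<open>0 < e\<close> by auto
    have "hausdorff_dist C C' \<le> inradius / 3 + inradius / 3"
      using C C' hausdorff_dist_commute[of A C]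
      by (intro hd_triangle[of C A C'] packing_copies[OF assms(2)] assms(4)) auto
    then have "C = C'"
      using packing_separated[OF assms(2) C(1) C'(1)] inradius by linarith
    with C' show ?thesis by simp
  qed
  then have "A = C"
    using C assms(2,4) packing_copies copy_compact copy_nonempty
    by (intro hausdorff_dist_eqI) blast+
  with C show ?thesis by simp
qed

lemma converges_unique:
  assumes "\<And>k. packing G K (X k)" "packing G K P" "packing G K Q" "converges X P" "converges X Q"
  shows "P = Q"
proof -
  have "P \<subseteq> Q" if "packing G K P" "packing G K Q" "converges X P" "converges X Q" for P Q
  proof
    fix A assume A: "A \<in> P"
    show "A \<in> Q"
      using converges_memI[OF assms(1) that(2,4)] converges_memD[OF that(3) A] packing_copies[OF that(1) A]
      by blast
  qed
  then show ?thesis using assms by blast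
qed

text \<open>Countably many tests ask whether a packing has an element near a given finite set of
  points, up to a given error. A diagonal subsequence eventually decides each test, and
  \<open>Q\<close> collects the copies approximated by all late packings. Elements that stay away
  from \<open>Q\<close> would accumulate at some copy \<open>A\<close>; the tests near
  \<open>A\<close> then hold infinitely often, hence eventually, which puts \<open>A\<close> into
  \<open>Q\<close>.\<close>

lemma convergent_subsequence:
  assumes X: "\<And>k. packing G K (X k)"
  obtains r Q where "strict_mono (r :: nat \<Rightarrow> nat)" "packing G K Q" "converges (X \<circ> r) Q"
proof -
  obtain D :: "'a set" where D: "countable D" "\<And>U. open U \<Longrightarrow> U \<noteq> {} \<Longrightarrow> \<exists>d\<in>D. d \<in> U"
    using countable_dense_exists by blast
  have "closure D = UNIV"
    using D(2)[of "- closure D"] closure_subset[of D] by auto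
  \<comment> \<open>The empty set belongs to \<open>C\<close> too. Its tests carry no information,
    and only tests with nonempty probes are evaluated below.\<close>
  define C where "C = {F. finite F \<and> F \<subseteq> D}"
  have C: "countable C" "C \<noteq> {}"
    using D countable_Collect_finite_subset by (auto simp: C_def)
  define f where "f = from_nat_into C"
  define test where "test n Y \<longleftrightarrow>
    (\<exists>A\<in>Y. hausdorff_dist A (f (fst (prod_decode n))) \<le> inverse (real (Suc (snd (prod_decode n)))))"
    for n and Y :: "'a set set"
  interpret subseqs "\<lambda>n s. (\<forall>k. test n (X (s k))) \<or> (\<forall>k. \<not> test n (X (s k)))"
  proof
    fix n and s :: "nat \<Rightarrow> nat"
    assume "strict_mono s"
    show "\<exists>r' :: nat \<Rightarrow> nat. strict_mono r' \<and> ((\<forall>k. test n (X ((s \<circ> r') k))) \<or> (\<forall>k. \<not> test n (X ((s \<circ> r') k))))"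
    proof (cases "eventually (\<lambda>k. test n (X (s k))) sequentially")
      case True
      then obtain N where "\<forall>k\<ge>N. test n (X (s k))" by (auto simp: eventually_sequentially)
      then have "\<forall>k. test n (X ((s \<circ> (\<lambda>k. N + k)) k))" by simp
      moreover have "strict_mono (\<lambda>k. N + k)" by (simp add: strict_mono_def)
      ultimately show ?thesis by blast
    next
      case False
      then obtain r' :: "nat \<Rightarrow> nat" where "strict_mono r'" "\<forall>k. \<not> test n (X (s (r' k)))"
        using not_eventually_sequentiallyD by blast
      then show ?thesis by (intro exI[of _ r']) simp
    qed
  qed
  define r where "r = diagseq"
  have r: "strict_mono r" unfolding r_def by (rule subseq_diagseq)
  have dich: "eventually (\<lambda>k. test n (X (r k))) sequentially \<or> eventually (\<lambda>k. \<not> test n (X (r k))) sequentially" for n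
  proof -
    have "(\<forall>k. test n (X ((diagseq \<circ> (+) (Suc n)) k))) \<or> (\<forall>k. \<not> test n (X ((diagseq \<circ> (+) (Suc n)) k)))"
      by (rule diagseq_holds) auto
    then have "(\<forall>k. test n (X (r (k + Suc n)))) \<or> (\<forall>k. \<not> test n (X (r (k + Suc n))))"
      by (simp add: r_def add.commute)
    then show ?thesis
      using eventually_sequentially_seg[of "\<lambda>k. test n (X (r k))" "Suc n"]
        eventually_sequentially_seg[of "\<lambda>k. \<not> test n (X (r k))" "Suc n"] by auto
  qed
  define Q where "Q = {A \<in> copies G K. \<forall>e>0. eventually (\<lambda>k. \<exists>B\<in>X (r k). hausdorff_dist A B \<le> e) sequentially}"
  have Q: "packing G K Q"
    by (rule packing_limit[of "X \<circ> r"]) (auto simp: X Q_def)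
  have "eventually (\<lambda>k. near e (X (r k)) Q) sequentially" if "0 < e" for e
  proof -
    \<comment> \<open>\<open>Q\<close> has only finitely many elements inside the ball, so their
      individual thresholds have a common one.\<close>
    have "eventually (\<lambda>k. \<forall>A\<in>{A \<in> Q. A \<subseteq> cball 0 (1 / e)}. \<exists>B\<in>X (r k). hausdorff_dist A B \<le> e) sequentially"
      using packing_finite_cball[OF Q] \<open>0 < e\<close> by (intro eventually_ball_finite) (auto simp: Q_def)
    moreover have "eventually (\<lambda>k. \<forall>B\<in>X (r k). B \<subseteq> cball 0 (1 / e) \<longrightarrow> (\<exists>A\<in>Q. hausdorff_dist B A \<le> e)) sequentially"
    proof (rule ccontr)
      assume "\<not> ?thesis"
      from not_eventually_sequentiallyD[OF this] obtain s :: "nat \<Rightarrow> nat" where s: "strict_mono s" and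
        bad: "\<forall>k. \<not> (\<forall>B\<in>X (r (s k)). B \<subseteq> cball 0 (1 / e) \<longrightarrow> (\<exists>A\<in>Q. hausdorff_dist B A \<le> e))"
        by (elim exE conjE) (rule that)
      have "\<exists>B. B \<in> X (r (s k)) \<and> B \<subseteq> cball 0 (1 / e) \<and> (\<forall>A\<in>Q. \<not> hausdorff_dist B A \<le> e)" for k
        using bad[rule_format, of k] by blast
      then obtain B where B: "\<And>k. B k \<in> X (r (s k))" "\<And>k. B k \<subseteq> cball 0 (1 / e)"
        "\<And>k A. A \<in> Q \<Longrightarrow> \<not> hausdorff_dist (B k) A \<le> e"
        by metis
      have cB: "B k \<in> copies G K" for k using B(1) packing_copies X by blast
      obtain s' g h where s': "strict_mono (s' :: nat \<Rightarrow> nat)" "h \<in> G"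
        and lim: "\<forall>e>0. eventually (\<lambda>k. hausdorff_dist (B (s' k)) (h ` K) \<le> e) sequentially"
        by (rule copies_sequence_compact[OF cB B(2)]) (rule that)
      define A where "A = h ` K"
      have cA: "A \<in> copies G K" using s' by (auto simp: A_def copies_def)
      have "eventually (\<lambda>k. \<exists>B\<in>X (r k). hausdorff_dist A B \<le> q) sequentially" if "0 < q" for q
      proof -
        obtain m where m: "inverse (real (Suc m)) < q / 2"
          using reals_Archimedean \<open>0 < q\<close> by (metis half_gt_zero)
        \<comment> \<open>A probe within \<open>d / 2\<close> of \<open>A\<close> is within
          \<open>d\<close> of \<open>B (s' k)\<close> for late \<open>k\<close>, and an element
          within \<open>d\<close> of the probe is within \<open>3 * d / 2\<close> of
          \<open>A\<close>, which is below \<open>q\<close>.\<close>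
        define d where "d = inverse (real (Suc m))"
        have d: "0 < d" "d < q / 2" using m by (simp_all add: d_def)
        obtain F where F: "finite F" "F \<subseteq> D" "F \<noteq> {}" "hausdorff_dist A F \<le> d / 2"
          by (rule approx_by_finite_subset_of_dense[OF copy_compact[OF cA] copy_nonempty[OF cA]
                \<open>closure D = UNIV\<close> half_gt_zero[OF d(1)]]) (rule that)
        then obtain i where i: "f i = F"
          using from_nat_into_surj[OF C(1), of F] by (auto simp: f_def C_def)
        have tri: "hausdorff_dist S U \<le> a + b"
          if "hausdorff_dist S T \<le> a" "hausdorff_dist T U \<le> b"
            "S \<in> insert F (copies G K)" "T \<in> insert F (copies G K)" "U \<in> insert F (copies G K)" for S T U a b
          by (rule hausdorff_dist_triangle_le[of S T U])
            (use that F(1,3) copy_compact copy_nonempty in \<open>auto intro: finite_imp_compact\<close>)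
        define n where "n = prod_encode (i, m)"
        have test: "test n Y \<longleftrightarrow> (\<exists>A\<in>Y. hausdorff_dist A F \<le> d)" for Y
          by (simp add: test_def n_def d_def i)
        have "eventually (\<lambda>k. hausdorff_dist (B (s' k)) A \<le> d / 2) sequentially"
          using lim[rule_format, of "d / 2"] d by (simp add: A_def)
        then have 1: "eventually (\<lambda>k. test n (X (r (s (s' k))))) sequentially"
        proof eventually_elim
          case (elim k)
          have "hausdorff_dist (B (s' k)) F \<le> d / 2 + d / 2"
            by (rule tri[OF elim F(4)]) (use cA cB in auto)
          then show ?case unfolding test using B(1) by auto
        qed
        \<comment> \<open>The bad elements make the test true infinitely often; it is therefore not
          eventually false, and \<open>dich\<close> leaves only the other case.\<close>
        have "\<not> eventually (\<lambda>k. \<not> test n (X (r k))) sequentially"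
        proof
          assume "eventually (\<lambda>k. \<not> test n (X (r k))) sequentially"
          then have "eventually (\<lambda>k. \<not> test n (X (r ((s \<circ> s') k)))) sequentially"
            by (rule eventually_subseq[OF strict_mono_o[OF s s'(1)]])
          with 1 have "eventually (\<lambda>k. False) sequentially"
            by eventually_elim simp
          then show False by simp
        qed
        then have "eventually (\<lambda>k. test n (X (r k))) sequentially" using dich by blast
        then show ?thesis
        proof eventually_elim
          case (elim k)
          then obtain E where E: "E \<in> X (r k)" "hausdorff_dist E F \<le> d" unfolding test by blast
          have "hausdorff_dist A E \<le> d / 2 + d"
            by (rule tri[OF F(4)]) (use cA E packing_copies X in \<open>auto simp: hausdorff_dist_commute\<close>)
          then show ?case using E d by (intro bexI[of _ E]) auto
        qed
      qed
      then have "A \<in> Q" using cA by (simp add: Q_def)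
      have "eventually (\<lambda>k. hausdorff_dist (B (s' k)) A \<le> e) sequentially"
        using lim \<open>0 < e\<close> by (simp add: A_def)
      with B(3)[OF \<open>A \<in> Q\<close>] show False by simp
    qed
    ultimately show ?thesis
    proof eventually_elim
      case (elim k)
      then show ?case by (auto simp: near_def hausdorff_dist_commute)
    qed
  qed
  then have "converges (X \<circ> r) Q" by (simp add: converges_def)
  with that r Q show thesis by blast
qed

end

section \<open>Returns and swaps\<close>

context packing_space
begin

lemma converges_translate:
  assumes "\<And>k. packing G K (X k)" "packing G K Q" "converges X Q"
  shows "converges (\<lambda>k. translate v (X k)) (translate v Q)"
  unfolding converges_def
proof (intro allI impI)
  fix e :: real assume "0 < e"
  define d where "d = min e (1 / (1 / e + norm v))"
  have pos: "0 < 1 / e + norm v" using \<open>0 < e\<close> by (intro add_pos_nonneg) auto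
  then have d: "0 < d" "d \<le> e" "d \<le> 1 / (1 / e + norm v)" using \<open>0 < e\<close> by (auto simp: d_def)
  then have le: "1 / e + norm v \<le> 1 / d" using pos by (simp add: field_simps)
  have "eventually (\<lambda>k. near d (X k) Q) sequentially"
    using assms d by (simp add: converges_def)
  then show "eventually (\<lambda>k. near e (translate v (X k)) (translate v Q)) sequentially"
  proof eventually_elim
    case (elim k)
    show ?case
      by (rule near_translate[OF _ _ elim d(1,2) le]) (use assms in \<open>auto simp: packing_def\<close>)
  qed
qed

lemma near_packing_trans:
  assumes "packing G K P" "packing G K Q" "packing G K R" "near e P Q" "near e Q R" "0 < e" "e \<le> 1 / 2"
  shows "near (2 * e) P R"
  using assms near_trans[of P Q R e] by (auto simp: packing_def)

text \<open>If the gaps between returns were unbounded, the centres of ever larger return-free balls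
  would give translates of \<open>P\<close> with a limit \<open>Q\<close>. By uniform recurrence
  \<open>P\<close> is a limit of translates of \<open>Q\<close>, so one fixed translate of
  \<open>Q\<close>, by \<open>u\<close>, is near the target. Then so is the translate of
  \<open>P\<close> by \<open>s (r k) + u\<close> for late \<open>k\<close>, although
  \<open>u\<close> is shorter than the radius of the return-free ball.\<close>

lemma uniformly_recurrent_returns:
  assumes P: "packing G K P" "uniformly_recurrent G K P" and "0 < e"
  obtains L where "\<forall>s. \<exists>w. norm w \<le> L \<and> near e (translate (s + w) P) (translate v P)"
proof (rule ccontr)
  assume "\<not> thesis"
  then have "\<exists>s. \<forall>w. norm w \<le> real k \<longrightarrow> \<not> near e (translate (s + w) P) (translate v P)" for k
    using that by metis
  then obtain s where s: "\<And>k w. norm w \<le> real k \<Longrightarrow> \<not> near e (translate (s k + w) P) (translate v P)"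
    by metis
  define d where "d = min (e / 2) (1 / 2)"
  have d: "0 < d" "d \<le> 1 / 2" "2 * d \<le> e" using \<open>0 < e\<close> by (auto simp: d_def)
  obtain r Q where r: "strict_mono (r :: nat \<Rightarrow> nat)" and Q: "packing G K Q"
    and lim: "converges ((\<lambda>k. translate (s k) P) \<circ> r) Q"
    using convergent_subsequence[OF packing_translate[OF P(1)]] by blast
  then have lim: "converges (\<lambda>k. translate (s (r k)) P) Q" by (simp add: o_def)
  then have "limit_of Q P" using limit_ofI[OF P(1) Q] by metis
  then have "limit_of P Q" using P Q by (auto simp: uniformly_recurrent_def)
  then obtain t where "converges (\<lambda>k. translate (t k) Q) P"
    using packings_converge_imp_converges by (auto simp: limit_of_def)
  from converges_translate[OF packing_translate[OF Q] P(1) this, of v]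
  have "eventually (\<lambda>k. near d (translate (v + t k) Q) (translate v P)) sequentially"
    using d by (simp add: converges_def)
  then obtain u where u: "near d (translate u Q) (translate v P)"
    by (auto simp: eventually_sequentially)
  from converges_translate[OF packing_translate[OF P(1)] Q lim, of u]
  have "eventually (\<lambda>k. near d (translate (u + s (r k)) P) (translate u Q)) sequentially"
    using d by (simp add: converges_def)
  moreover have "eventually (\<lambda>k. norm u \<le> real k) sequentially"
    by (metis eventually_sequentiallyI nat_ceiling_le_eq)
  ultimately have "eventually (\<lambda>k. False) sequentially"
  proof eventually_elim
    case (elim k)
    have "near (2 * d) (translate (u + s (r k)) P) (translate v P)"
      by (rule near_packing_trans[OF _ _ _ elim(1) u d(1,2)]) (auto intro: packing_translate P Q)
    then have "near e (translate (s (r k) + u) P) (translate v P)"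
      using near_mono[OF _ _ d(3)] d(1) by (simp add: add.commute)
    moreover have "norm u \<le> real (r k)"
      using elim(2) seq_suble[OF r, of k] by linarith
    ultimately show False using s by blast
  qed
  then show False by simp
qed

text \<open>Finiteness is implicit: \<open>card T\<close> is positive, and \<open>S\<close> lies in
  a ball, which makes it finite when \<open>P\<close> is a packing. So \<open>card S\<close> is then
  never the default value of an infinite set.\<close>

definition swappable :: "real \<Rightarrow> 'a set set \<Rightarrow> bool" where
  "swappable m P \<longleftrightarrow>
     (\<exists>S T. S \<subseteq> P \<and> T \<subseteq> copies G K \<and> card T = Suc (card S) \<and> T \<inter> (P - S) = {} \<and>
        packing G K ((P - S) \<union> T) \<and> (\<forall>A\<in>S \<union> T. A \<subseteq> cball 0 m))"

text \<open>A swap involves finitely many compact sets, which lie in one ball. An integer radius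
  suffices, so only countably many conditions have to be avoided later.\<close>

lemma not_completely_saturated_swappable:
  assumes "packing G K P" "\<not> completely_saturated G K P"
  obtains k :: nat where "swappable (real k) P"
proof -
  obtain n S T where n: "n \<ge> 1" and S: "S \<subseteq> P" "finite S" "card S = n - 1"
    and T: "T \<subseteq> copies G K" "finite T" "card T = n" "T \<inter> (P - S) = {}" "packing G K ((P - S) \<union> T)"
    using assms by (auto simp: completely_saturated_def n_saturated_def)
  have "bounded (\<Union>(S \<union> T))"
  proof (rule bounded_Union)
    show "\<forall>A\<in>S \<union> T. bounded A"
      using S T packing_copies[OF assms(1)] copy_compact compact_imp_bounded by blast
  qed (use S T in auto)
  then obtain b where "\<Union>(S \<union> T) \<subseteq> cball 0 b"
    using bounded_subset_ballD ball_subset_cball by (metis order_trans)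
  moreover obtain k :: nat where "b \<le> real k" using real_arch_simple by blast
  ultimately have "\<forall>A\<in>S \<union> T. A \<subseteq> cball 0 (real k)" by fastforce
  then have "swappable (real k) P"
    unfolding swappable_def using n S T by (intro exI[of _ S] exI[of _ T]) auto
  with that show thesis .
qed

text \<open>Choosing partners is injective: elements with a common partner would be within
  \<open>2 * e\<close> of each other. Applied in both directions, this makes cardinalities agree
  near a limit.\<close>

lemma near_card_le:
  assumes "packing G K P" "\<And>A. A \<in> P \<Longrightarrow> A \<subseteq> cball 0 (1 / e)" "packing G K Q" "finite Q"
    "near e P Q" "2 * e < inradius"
  shows "card P \<le> card Q"
proof -
  have "\<exists>B\<in>Q. hausdorff_dist A B \<le> e" if "A \<in> P" for A
    using assms that by (auto simp: near_def)
  then obtain f where f: "\<And>A. A \<in> P \<Longrightarrow> f A \<in> Q" "\<And>A. A \<in> P \<Longrightarrow> hausdorff_dist A (f A) \<le> e"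
    by metis
  have "inj_on f P"
  proof (rule inj_onI)
    fix A B assume AB: "A \<in> P" "B \<in> P" "f A = f B"
    have "hausdorff_dist A B \<le> e + e"
      using f(2)[OF AB(1)] f(2)[OF AB(2)] AB(3) hausdorff_dist_commute[of B "f B"]
      by (intro hd_triangle[of A "f A" B] packing_copies[OF assms(1)] packing_copies[OF assms(3)] AB f(1))
        simp_all
    then show "A = B" using packing_separated[OF assms(1)] AB assms(6) by auto
  qed
  then show ?thesis using card_inj_on_le[of f P Q] f assms(4) by blast
qed

lemma converges_cball:
  assumes X: "\<And>k. packing G K (X k)" and Q: "packing G K Q" and lim: "converges X Q"
    and m: "\<And>k A. A \<in> X k \<Longrightarrow> A \<subseteq> cball 0 m"
  shows "\<And>A. A \<in> Q \<Longrightarrow> A \<subseteq> cball 0 m"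
    and "eventually (\<lambda>k. card (X k) = card Q) sequentially"
proof -
  show sub: "A \<subseteq> cball 0 m" if A: "A \<in> Q" for A
  proof -
    \<comment> \<open>Closeness only gives a slightly larger ball; the radius \<open>m\<close> is
      recovered by letting \<open>e\<close> tend to 0.\<close>
    have ball: "A \<subseteq> cball 0 (m + e)" if "0 < e" for e
    proof -
      have "eventually (\<lambda>k. \<exists>B\<in>X k. hausdorff_dist A B \<le> e) sequentially"
        using converges_memD[OF lim A packing_copies[OF Q A] that] .
      then obtain k B where B: "B \<in> X k" "hausdorff_dist A B \<le> e"
        by (auto simp: eventually_sequentially)
      show ?thesis
        by (rule hd_ball[OF packing_copies[OF X B(1)] packing_copies[OF Q A] _ m[OF B(1)]])
          (use B(2) in \<open>simp_all add: hausdorff_dist_commute\<close>)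
    qed
    have "norm x \<le> m" if "x \<in> A" for x
    proof (rule field_le_epsilon)
      show "norm x \<le> m + e" if "0 < e" for e
        using ball[OF that] \<open>x \<in> A\<close> by auto
    qed
    then show ?thesis by auto
  qed
  \<comment> \<open>Below the separation constant, and so small that the ball of radius
    \<open>m\<close> lies in the ball examined at scale \<open>d\<close>.\<close>
  define d where "d = min (inradius / 3) (1 / (\<bar>m\<bar> + 1))"
  have d: "0 < d" "2 * d < inradius" "d \<le> 1 / (\<bar>m\<bar> + 1)" using inradius by (auto simp: d_def)
  then have "\<bar>m\<bar> + 1 \<le> 1 / d" by (simp add: field_simps)
  then have md: "cball 0 m \<subseteq> cball (0::'a) (1 / d)" by auto
  have fin: "finite P" if "packing G K P" "\<And>A. A \<in> P \<Longrightarrow> A \<subseteq> cball 0 m" for P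
    using packing_finite_cball[OF that(1), of m] that(2) by (simp add: Collect_conj_eq Int_absorb2 subset_iff)
  have "eventually (\<lambda>k. near d (X k) Q) sequentially" using lim d by (simp add: converges_def)
  then show "eventually (\<lambda>k. card (X k) = card Q) sequentially"
  proof eventually_elim
    case (elim k)
    show ?case
    proof (rule antisym)
      show "card (X k) \<le> card Q"
        using md m sub by (intro near_card_le[OF X _ Q fin[OF Q] elim d(2)]) blast+
      show "card Q \<le> card (X k)"
        using md m sub by (intro near_card_le[OF Q _ X fin[OF X] near_sym[OF elim] d(2)]) blast+
    qed
  qed
qed

text \<open>A common limit element would have approximants in \<open>X k\<close> and in
  \<open>Y k\<close> that are closer than \<open>inradius\<close> within one packing, hence
  equal.\<close>

lemma converges_disjoint:
  assumes "\<And>k. packing G K (X k \<union> Y k)" "\<And>k. X k \<inter> Y k = {}" "converges X P" "converges Y Q"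
    "P \<subseteq> copies G K"
  shows "P \<inter> Q = {}"
proof (rule ccontr)
  assume "P \<inter> Q \<noteq> {}"
  then obtain A where A: "A \<in> P" "A \<in> Q" "A \<in> copies G K" using assms(5) by blast
  have "eventually (\<lambda>k. (\<exists>B\<in>X k. hausdorff_dist A B \<le> inradius / 3) \<and>
      (\<exists>C\<in>Y k. hausdorff_dist A C \<le> inradius / 3)) sequentially"
    using converges_memD[OF assms(3) A(1,3), of "inradius / 3"]
      converges_memD[OF assms(4) A(2,3), of "inradius / 3"] inradius(1)
    by (simp add: eventually_conj_iff)
  then obtain k B C where BC: "B \<in> X k" "hausdorff_dist A B \<le> inradius / 3"
      "C \<in> Y k" "hausdorff_dist A C \<le> inradius / 3"
    by (auto simp: eventually_sequentially)
  have "hausdorff_dist B C \<le> inradius / 3 + inradius / 3"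
    by (rule hd_triangle[of B A C])
      (use BC A packing_copies[OF assms(1)] hausdorff_dist_commute[of A B] in auto)
  then have "B = C"
    using packing_separated[OF assms(1)[of k], of B C] BC inradius by auto
  with BC assms(2)[of k] show False by blast
qed

text \<open>The removed part \<open>S\<close>, the inserted part \<open>T\<close> and the untouched
  part \<open>Z\<close> are followed separately along a common subsequence. Uniqueness of limits
  splits \<open>Q\<close> into the limits of \<open>S\<close> and \<open>Z\<close>; disjointness and
  cardinalities survive by separation, so the limits of \<open>S\<close> and \<open>T\<close> form a
  swap of \<open>Q\<close>.\<close>

lemma swappable_limit:
  assumes X: "\<And>k. packing G K (X k)" "\<And>k. swappable m (X k)" and Q: "packing G K Q" "converges X Q"
  shows "swappable m Q"
proof -
  obtain S T where S: "\<And>k. S k \<subseteq> X k" and T: "\<And>k. T k \<subseteq> copies G K" "\<And>k. card (T k) = Suc (card (S k))"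
    "\<And>k. T k \<inter> (X k - S k) = {}" "\<And>k. packing G K ((X k - S k) \<union> T k)"
    "\<And>k A. A \<in> S k \<union> T k \<Longrightarrow> A \<subseteq> cball 0 m"
    using X(2) unfolding swappable_def by metis
  define Z where "Z k = X k - S k" for k
  have pack: "packing G K (S k)" "packing G K (T k)" "packing G K (Z k)" "packing G K (Z k \<union> T k)"
    "packing G K (S k \<union> Z k)" for k
    using packing_subset[OF X(1)[of k], of "S k"] packing_subset[OF T(4)[of k], of "T k"]
      packing_subset[OF X(1)[of k], of "Z k"] T(4)[of k] X(1)[of k] S[of k]
    by (auto simp: Z_def Un_absorb1)
  obtain r1 S' where r1: "strict_mono (r1 :: nat \<Rightarrow> nat)" "packing G K S'" "converges (S \<circ> r1) S'"
    by (rule convergent_subsequence[OF pack(1)]) (rule that)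
  obtain r2 T' where r2: "strict_mono (r2 :: nat \<Rightarrow> nat)" "packing G K T'" "converges (T \<circ> r1 \<circ> r2) T'"
    by (rule convergent_subsequence[of "T \<circ> r1"]) (auto simp: pack intro: that)
  obtain r3 Z' where r3: "strict_mono (r3 :: nat \<Rightarrow> nat)" "packing G K Z'" "converges (Z \<circ> r1 \<circ> r2 \<circ> r3) Z'"
    by (rule convergent_subsequence[of "Z \<circ> r1 \<circ> r2"]) (auto simp: pack intro: that)
  define r where "r = r1 \<circ> r2 \<circ> r3"
  have lim: "converges (\<lambda>k. S (r k)) S'" "converges (\<lambda>k. T (r k)) T'" "converges (\<lambda>k. Z (r k)) Z'"
    using converges_subseq[OF converges_subseq[OF r1(3) r2(1)] r3(1)] converges_subseq[OF r2(3) r3(1)] r3(3)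
    by (simp_all add: r_def o_def)
  have r: "strict_mono r" unfolding r_def by (intro strict_mono_o r1 r2 r3)
  have ZT: "packing G K (Z' \<union> T')"
  proof (rule packing_limit)
    show "packing G K (Z (r k) \<union> T (r k))" for k by (rule pack)
    show c: "Z' \<union> T' \<subseteq> copies G K" using r2 r3 by (auto simp: packing_def)
    show "eventually (\<lambda>k. \<exists>B\<in>Z (r k) \<union> T (r k). hausdorff_dist A B \<le> e) sequentially"
      if "A \<in> Z' \<union> T'" "0 < e" for A e
      using converges_memD[OF converges_Un[OF lim(3,2)] that(1)] that c by blast
  qed
  have SZ: "packing G K (S' \<union> Z')"
  proof (rule packing_limit)
    show "packing G K (S (r k) \<union> Z (r k))" for k by (rule pack)
    show c: "S' \<union> Z' \<subseteq> copies G K" using r1 r3 by (auto simp: packing_def)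
    show "eventually (\<lambda>k. \<exists>B\<in>S (r k) \<union> Z (r k). hausdorff_dist A B \<le> e) sequentially"
      if "A \<in> S' \<union> Z'" "0 < e" for A e
      using converges_memD[OF converges_Un[OF lim(1,3)] that(1)] that c by blast
  qed
  have "S k \<union> Z k = X k" for k using S by (auto simp: Z_def)
  then have "converges (X \<circ> r) (S' \<union> Z')"
    using converges_Un[OF lim(1,3)] by (simp add: o_def)
  then have Qeq: "Q = S' \<union> Z'"
    using converges_unique[of "X \<circ> r", OF _ Q(1) SZ converges_subseq[OF Q(2) r]] X by auto
  have "S' \<inter> Z' = {}"
    by (rule converges_disjoint[OF _ _ lim(1,3)]) (use pack r1 in \<open>auto simp: Z_def packing_def\<close>)
  then have QS: "Q - S' = Z'" using Qeq by auto
  have TZ: "T' \<inter> Z' = {}"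
    by (rule converges_disjoint[OF _ _ lim(2,3)])
      (use pack(4) T(3) r2 in \<open>auto simp: Z_def Un_commute packing_def\<close>)
  have "eventually (\<lambda>k. card (S (r k)) = card S') sequentially"
    by (rule converges_cball(2)[OF pack(1) r1(2) lim(1)]) (use T(5) in auto)
  moreover have "eventually (\<lambda>k. card (T (r k)) = card T') sequentially"
    by (rule converges_cball(2)[OF pack(2) r2(2) lim(2)]) (use T(5) in auto)
  ultimately have "eventually (\<lambda>k. card T' = Suc (card S')) sequentially"
    by eventually_elim (metis T(2))
  then have cd: "card T' = Suc (card S')" by simp
  have "A \<subseteq> cball 0 m" if "A \<in> S' \<union> T'" for A
    using that converges_cball(1)[OF pack(1) r1(2) lim(1), of m A]
      converges_cball(1)[OF pack(2) r2(2) lim(2), of m A] T(5) by blast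
  then show ?thesis
    unfolding swappable_def using QS Qeq ZT r2(2) cd TZ
    by (intro exI[of _ S'] exI[of _ T']) (auto simp: packing_def)
qed

text \<open>Sequential form of openness: \<open>m\<close>-swappable packings at scales tending to 0
  from \<open>P\<close> would converge to \<open>P\<close>.\<close>

lemma not_swappable_stable:
  assumes P: "packing G K P" "\<not> swappable m P"
  obtains e where "0 < e" "\<forall>R. packing G K R \<longrightarrow> near e R P \<longrightarrow> \<not> swappable m R"
proof (rule ccontr)
  note obtained = that
  assume "\<not> thesis"
  then have "\<exists>R. packing G K R \<and> near (inverse (real (Suc k))) R P \<and> swappable m R" for k
    using obtained[of "inverse (real (Suc k))"] by auto
  then obtain R where R: "\<And>k. packing G K (R k)" "\<And>k. near (inverse (real (Suc k))) (R k) P"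
    "\<And>k. swappable m (R k)"
    by metis
  have "eventually (\<lambda>k. near e (R k) P) sequentially" if "0 < e" for e
  proof -
    have "eventually (\<lambda>k. inverse (real (Suc k)) < e) sequentially"
      using LIMSEQ_inverse_real_of_nat that by (metis order_tendstoD(2))
    then show ?thesis
      by eventually_elim (use near_mono[OF R(2)] in auto)
  qed
  then have "converges R P" by (simp add: converges_def)
  then show False using swappable_limit[OF R(1,3) P(1)] P(2) by simp
qed

lemma near_refl: "packing G K P \<Longrightarrow> 0 < e \<Longrightarrow> near e P P"
  unfolding near_def using hd_self packing_copies by (metis less_imp_le)

text \<open>A Baire category argument, unrolled: the translates of \<open>P\<close> are steered through a nested
  sequence of neighbourhoods, the \<open>k\<close>-th of which contains no \<open>k\<close>-swappable packing.\<close>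

lemma limit_without_swaps:
  assumes P: "packing G K P" "uniformly_recurrent G K P"
    and rare: "\<And>m L. \<exists>s. \<forall>w. norm w \<le> L \<longrightarrow> \<not> swappable m (translate (s + w) P)"
  obtains Q where "packing G K Q" "limit_of Q P" "\<And>k::nat. \<not> swappable (real k) Q"
proof -
  \<comment> \<open>A translation vector paired with the radius of a neighbourhood of that translate
    of \<open>P\<close> free of \<open>k\<close>-swappable packings. The bound \<open>1 / 2\<close>
    is what \<open>near_trans\<close> asks for.\<close>
  define good where "good k te \<longleftrightarrow> 0 < snd te \<and> snd te \<le> 1 / 2 \<and>
      (\<forall>R. packing G K R \<longrightarrow> near (snd te) R (translate (fst te) P) \<longrightarrow> \<not> swappable (real k) R)"
    for k and te :: "'a \<times> real"
  have step: "\<exists>y. good k y \<and> snd y \<le> e / 4 \<and> near (e / 4) (translate (fst y) P) (translate t P)"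
    if e: "0 < e" for k e t
  proof -
    obtain L where L: "\<forall>s. \<exists>w. norm w \<le> L \<and> near (e / 4) (translate (s + w) P) (translate t P)"
      by (rule uniformly_recurrent_returns[OF P, of "e / 4"]) (use e in auto)
    \<comment> \<open>All translations within \<open>L\<close> of \<open>s\<close> avoid swaps, and
      by the choice of \<open>L\<close> one of them brings \<open>P\<close> back near
      \<open>translate t P\<close>.\<close>
    obtain s where s: "\<forall>w. norm w \<le> L \<longrightarrow> \<not> swappable (real k) (translate (s + w) P)"
      using rare by blast
    obtain w where w: "norm w \<le> L" "near (e / 4) (translate (s + w) P) (translate t P)" using L by blast
    then have "\<not> swappable (real k) (translate (s + w) P)" using s by blast
    then obtain d where d: "0 < d"
      "\<forall>R. packing G K R \<longrightarrow> near d R (translate (s + w) P) \<longrightarrow> \<not> swappable (real k) R"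
      by (rule not_swappable_stable[OF packing_translate[OF P(1)]])
    define d' where "d' = min d (min (1 / 2) (e / 4))"
    have d': "0 < d'" "d' \<le> d" "d' \<le> 1 / 2" "d' \<le> e / 4" using d e by (auto simp: d'_def)
    have "good k (s + w, d')"
      unfolding good_def using d d' near_mono[OF _ d'(1,2)] by auto
    then show ?thesis using d' w by (intro exI[of _ "(s + w, d')"]) auto
  qed
  have "\<exists>f. \<forall>n. good n (f n) \<and> (snd (f (Suc n)) \<le> snd (f n) / 4 \<and>
      near (snd (f n) / 4) (translate (fst (f (Suc n))) P) (translate (fst (f n)) P))"
  proof (rule dependent_nat_choice)
    show "\<exists>x. good 0 x" using step[of 1 0 0] zero_less_one by blast
    show "\<exists>y. good (Suc n) y \<and> (snd y \<le> snd x / 4 \<and>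
        near (snd x / 4) (translate (fst y) P) (translate (fst x) P))" if "good n x" for x n
      using step[of "snd x" "Suc n" "fst x"] that by (auto simp: good_def)
  qed
  then obtain f where f: "\<And>n. good n (f n)" "\<And>n. snd (f (Suc n)) \<le> snd (f n) / 4"
    "\<And>n. near (snd (f n) / 4) (translate (fst (f (Suc n))) P) (translate (fst (f n)) P)"
    by metis
  define t e where "t n = fst (f n)" and "e n = snd (f n)" for n
  have e: "0 < e n" "e n \<le> 1 / 2" "e (Suc n) \<le> e n / 4" for n
    using f by (auto simp: e_def good_def)
  have pt: "packing G K (translate v P)" for v using packing_translate P by blast
  \<comment> \<open>The radii shrink by a factor 4, so the induction hypothesis at
    \<open>Suc k\<close> gives closeness \<open>e (Suc k) / 2\<close>, below \<open>e k / 4\<close>.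
    The step from \<open>Suc k\<close> to \<open>k\<close> costs \<open>e k / 4\<close> as well, and
    the factor 2 of \<open>near_trans\<close> makes \<open>e k / 2\<close>.\<close>
  have chain: "near (e k / 2) (translate (t (k + n)) P) (translate (t k) P)" for k n
  proof (induction n arbitrary: k)
    case 0
    show ?case using near_refl[OF pt] e[of k] by simp
  next
    case (Suc n)
    have "near (e k / 4) (translate (t (Suc k + n)) P) (translate (t (Suc k)) P)"
      using near_mono[OF Suc[of "Suc k"]] e[of "Suc k"] e[of k] by simp
    moreover have "near (e k / 4) (translate (t (Suc k)) P) (translate (t k) P)"
      using f(3)[of k] by (simp add: t_def e_def)
    ultimately have "near (2 * (e k / 4)) (translate (t (Suc k + n)) P) (translate (t k) P)"
      using near_packing_trans[OF pt pt pt, of "e k / 4"] e[of k] by simp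
    then show ?case by simp
  qed
  obtain r Q where r: "strict_mono (r :: nat \<Rightarrow> nat)" and Q: "packing G K Q"
    and lim: "converges ((\<lambda>k. translate (t k) P) \<circ> r) Q"
    by (rule convergent_subsequence[OF pt]) (rule that)
  then have lim: "converges (\<lambda>k. translate (t (r k)) P) Q" by (simp add: o_def)
  have "\<not> swappable (real k) Q" for k
  proof -
    have "eventually (\<lambda>j. near (e k / 2) (translate (t (r j)) P) Q \<and> k \<le> j) sequentially"
      using lim e[of k] by (auto simp: converges_def intro: eventually_conj eventually_ge_at_top)
    then obtain j where j: "near (e k / 2) (translate (t (r j)) P) Q" "k \<le> j"
      by (auto simp: eventually_sequentially)
    have "k \<le> r j" using seq_suble[OF r, of j] j by simp
    then have "near (e k / 2) (translate (t (r j)) P) (translate (t k) P)"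
      using chain[of k "r j - k"] by simp
    \<comment> \<open>Passing to the limit costs another factor 2 and uses up exactly the radius
      \<open>e k\<close>.\<close>
    then have "near (2 * (e k / 2)) Q (translate (t k) P)"
      using near_packing_trans[OF Q pt pt near_sym[OF j(1)]] e[of k] by auto
    then show ?thesis using f(1)[of k] Q by (auto simp: good_def t_def e_def)
  qed
  moreover have "limit_of Q P" by (rule limit_ofI[OF P(1) Q lim])
  ultimately show ?thesis using that Q by blast
qed

end

section \<open>Volumes of isometric images and cubes\<close>

text \<open>By Vitali covering, an open set is a countable disjoint union of balls up to a null set.
  An isometry maps these to balls of the same radii and, being Lipschitz, keeps the remainder
  null.\<close>

lemma emeasure_isometric_open:
  fixes g :: "'a::euclidean_space \<Rightarrow> 'a"
  assumes g: "isometric g" and U: "open U"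
  shows "emeasure lborel (g ` U) = emeasure lborel U"
proof -
  define I where "I = {(x, r). 0 < r \<and> ball x r \<subseteq> U}"
  have cover: "\<exists>i. i \<in> I \<and> x \<in> ball (fst i) (snd i) \<and> snd i < d" if "x \<in> U" "0 < d" for x d
  proof -
    obtain e where "0 < e" "ball x e \<subseteq> U" using U \<open>x \<in> U\<close> by (metis openE)
    moreover have "ball x (min e (d / 2)) \<subseteq> ball x e" by auto
    ultimately show ?thesis
      using \<open>0 < d\<close> by (intro exI[of _ "(x, min e (d / 2))"]) (auto simp: I_def)
  qed
  obtain C where C: "countable C" "C \<subseteq> I"
    "pairwise (\<lambda>i j. disjnt (ball (fst i) (snd i)) (ball (fst j) (snd j))) C"
    "negligible (U - (\<Union>i\<in>C. ball (fst i) (snd i)))"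
    by (rule Vitali_covering_theorem_balls[of U I fst snd], erule (1) cover) (rule that)
  define V where "V = (\<Union>i\<in>C. ball (fst i) (snd i))"
  have "ball (fst i) (snd i) \<subseteq> U" if "i \<in> C" for i
    using subsetD[OF C(2) that] by (simp add: I_def split_def)
  then have VU: "V \<subseteq> U" and oV: "open V" by (auto simp: V_def)
  have inj: "inj g" using g by (simp add: isometric_def bij_is_inj)
  have gopen: "open (g ` W)" if "open W" for W
    using isometric_interior_image[OF g, of W] that by (metis interior_open open_interior)
  have gV: "g ` V = (\<Union>i\<in>C. ball (g (fst i)) (snd i))"
    by (simp add: V_def image_UN isometric_ball_image[OF g])
  have "emeasure lborel (g ` V) = (\<integral>\<^sup>+i. emeasure lborel (ball (g (fst i)) (snd i)) \<partial>count_space C)"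
    unfolding gV
  proof (rule emeasure_UN_countable)
    show "disjoint_family_on (\<lambda>i. ball (g (fst i)) (snd i)) C"
      unfolding disjoint_family_on_def isometric_ball_image[OF g, symmetric] image_Int[OF inj, symmetric]
      using C(3) by (auto simp: pairwise_def disjnt_def)
  qed (use C in auto)
  also have "\<dots> = (\<integral>\<^sup>+i. emeasure lborel (ball (fst i) (snd i)) \<partial>count_space C)"
    using C(2) by (intro nn_integral_cong) (auto simp: emeasure_ball I_def less_imp_le)
  also have "\<dots> = emeasure lborel V"
    unfolding V_def
    by (rule emeasure_UN_countable[symmetric])
      (use C in \<open>auto simp: disjoint_family_on_def pairwise_def disjnt_def\<close>)
  finally have eV: "emeasure lborel (g ` V) = emeasure lborel V" .
  have null: "emeasure lborel N = 0" if "N \<in> sets borel" "negligible N" for N :: "'a set"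
    using that negligible_iff_null_sets[of N] by (simp add: null_sets_def)
  have "negligible (g ` (U - V))"
  proof (rule negligible_locally_Lipschitz_image)
    show "\<exists>T B. open T \<and> x \<in> T \<and> (\<forall>y\<in>(U - V) \<inter> T. norm (g y - g x) \<le> B * norm (y - x))" for x
      using g by (intro exI[of _ UNIV] exI[of _ 1]) (auto simp: isometric_def dist_norm)
  qed (use C in \<open>auto simp: V_def\<close>)
  then have "emeasure lborel (g ` U - g ` V) = 0"
    using gopen[OF U] gopen[OF oV] by (intro null) (auto simp: image_set_diff[OF inj])
  moreover have "emeasure lborel (U - V) = 0"
    using U oV C(4) by (intro null) (auto simp: V_def)
  moreover have add: "emeasure lborel W = emeasure lborel W' + emeasure lborel (W - W')"
    if "W' \<subseteq> W" "open W" "open W'" for W W' :: "'a set"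
    using plus_emeasure[of W' lborel "W - W'"] that by (auto simp: Un_absorb1)
  ultimately show ?thesis
    using eV add[OF VU U oV] add[OF image_mono[OF VU] gopen[OF U] gopen[OF oV]] by simp
qed

text \<open>A compact set is a ball minus an open set, which reduces the claim to open sets.\<close>

lemma measure_isometric_compact:
  fixes g :: "'a::euclidean_space \<Rightarrow> 'a"
  assumes g: "isometric g" and S: "compact S"
  shows "measure lborel (g ` S) = measure lborel S"
proof -
  have inj: "inj g" using g by (simp add: isometric_def bij_is_inj)
  obtain R where R: "S \<subseteq> ball 0 R"
    using bounded_subset_ballD[OF compact_imp_bounded[OF S]] by blast
  have gS: "compact (g ` S)"
    by (intro compact_continuous_image isometric_continuous_on g S)
  have eq: "measure lborel T = measure lborel (ball x R) - measure lborel (ball x R - T)"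
    if "compact T" "T \<subseteq> ball x R" for T and x :: 'a
    using that emeasure_lborel_ball_finite[of x R]
    by (subst measure_Diff) (auto simp: compact_imp_closed less_top)
  have "measure lborel (g ` S) = measure lborel (g ` ball 0 R) - measure lborel (g ` (ball 0 R - S))"
    using eq[OF gS, of "g 0"] image_mono[OF R, of g]
    by (simp add: image_set_diff[OF inj] flip: isometric_ball_image[OF g])
  also have "\<dots> = measure lborel (ball (0::'a) R) - measure lborel (ball 0 R - S)"
    using emeasure_isometric_open[OF g] S by (simp add: measure_def open_Diff compact_imp_closed)
  also have "\<dots> = measure lborel S" using eq[OF S R] by simp
  finally show ?thesis .
qed

section \<open>Cubes, the cubic lattice and ratios of ball volumes\<close>

definition cube :: "'a::euclidean_space \<Rightarrow> real \<Rightarrow> 'a set" where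
  "cube a l = cbox a (a + l *\<^sub>R One)"

definition open_cube :: "'a::euclidean_space \<Rightarrow> real \<Rightarrow> 'a set" where
  "open_cube a l = box a (a + l *\<^sub>R One)"

lemma mem_cube: "x \<in> cube a l \<longleftrightarrow> (\<forall>b\<in>Basis. a \<bullet> b \<le> x \<bullet> b \<and> x \<bullet> b \<le> a \<bullet> b + l)"
  by (simp add: cube_def mem_box inner_add_left)

lemma mem_open_cube: "x \<in> open_cube a l \<longleftrightarrow> (\<forall>b\<in>Basis. a \<bullet> b < x \<bullet> b \<and> x \<bullet> b < a \<bullet> b + l)"
  by (simp add: open_cube_def mem_box inner_add_left)

lemma measure_cube:
  fixes a :: "'a::euclidean_space"
  assumes "0 \<le> l"
  shows "measure lborel (cube a l) = l ^ DIM('a)" "measure lborel (open_cube a l) = l ^ DIM('a)"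
  using assms by (auto simp: cube_def open_cube_def measure_lborel_cbox_eq measure_lborel_box_eq
      inner_add_left inner_diff_left)

lemma interior_cube: "interior (cube a l) = open_cube a l"
  by (simp add: cube_def open_cube_def)

lemma open_cube_subset: "open_cube a l \<subseteq> cube a l"
  by (simp add: cube_def open_cube_def box_subset_cbox)

lemma cube_dist:
  fixes x y :: "'a::euclidean_space"
  assumes "x \<in> cube a l" "y \<in> cube a l"
  shows "dist x y \<le> l * DIM('a)"
proof -
  have "norm (x - y) \<le> (\<Sum>b\<in>Basis. \<bar>(x - y) \<bullet> b\<bar>)" by (rule norm_le_l1)
  also have "\<dots> \<le> (\<Sum>b\<in>(Basis :: 'a set). l)"
    using assms by (intro sum_mono) (force simp: mem_cube inner_diff_left)
  finally show ?thesis by (simp add: dist_norm mult.commute)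
qed

lemma cube_translateI: "x \<in> cube a l \<Longrightarrow> z + x \<in> cube (a + z) l"
  by (simp add: mem_cube inner_add_left)

definition cubic_lattice :: "real \<Rightarrow> 'a::euclidean_space set" where
  "cubic_lattice l = {z. \<forall>b\<in>Basis. z \<bullet> b / l \<in> \<int>}"

lemma lattice_disjoint:
  assumes "0 < l" "z \<in> cubic_lattice l" "w \<in> cubic_lattice l" "z \<noteq> w"
  shows "open_cube (a + z) l \<inter> open_cube (a + w) l = {}"
proof -
  obtain b where b: "b \<in> Basis" "z \<bullet> b \<noteq> w \<bullet> b"
    using assms(4) by (metis euclidean_eqI)
  obtain i j :: int where ij: "z \<bullet> b / l = of_int i" "w \<bullet> b / l = of_int j"
    using assms b by (auto simp: cubic_lattice_def) (metis Ints_cases)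
  then have eq: "z \<bullet> b = of_int i * l" "w \<bullet> b = of_int j * l"
    using assms(1) by (auto simp: field_simps)
  have "\<not> (\<exists>x. x \<in> open_cube (a + z) l \<and> x \<in> open_cube (a + w) l)"
  proof
    assume "\<exists>x. x \<in> open_cube (a + z) l \<and> x \<in> open_cube (a + w) l"
    then have "of_int i * l < of_int j * l + l" "of_int j * l < of_int i * l + l"
      using b eq by (fastforce simp: mem_open_cube inner_add_left)+
    then have "of_int i * l < of_int (j + 1) * l" "of_int j * l < of_int (i + 1) * l"
      by (simp_all add: algebra_simps)
    then have "i < j + 1" "j < i + 1" using assms(1) by (simp_all only: mult_less_cancel_right_pos of_int_less_iff)
    then show False using b eq by simp
  qed
  then show ?thesis by blast
qed

lemma lattice_cover:
  assumes "0 < l"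
  obtains z where "z \<in> cubic_lattice l" "x \<in> cube (a + z) l"
proof
  define f where "f b = of_int \<lfloor>(x - a) \<bullet> b / l\<rfloor> * l" for b
  define z where "z = (\<Sum>b\<in>Basis. f b *\<^sub>R b)"
  have z: "z \<bullet> b = f b" if "b \<in> Basis" for b
    using that by (simp add: z_def)
  show "z \<in> cubic_lattice l" using assms by (simp add: cubic_lattice_def z f_def)
  show "x \<in> cube (a + z) l"
    unfolding mem_cube
  proof
    fix b :: 'a assume b: "b \<in> Basis"
    have "of_int \<lfloor>(x - a) \<bullet> b / l\<rfloor> * l \<le> (x - a) \<bullet> b / l * l"
      "(x - a) \<bullet> b / l * l \<le> (of_int \<lfloor>(x - a) \<bullet> b / l\<rfloor> + 1) * l"
      using assms by (intro mult_right_mono; linarith)+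
    then have "f b \<le> (x - a) \<bullet> b" "(x - a) \<bullet> b \<le> f b + l"
      using assms by (simp_all only: f_def distrib_right) auto
    then show "(a + z) \<bullet> b \<le> x \<bullet> b \<and> x \<bullet> b \<le> (a + z) \<bullet> b + l"
      by (simp add: inner_add_left inner_diff_left z b)
  qed
qed

lemma measure_ball_ratio:
  fixes p q :: "'a::euclidean_space"
  assumes "0 < r" "0 \<le> s"
  shows "measure lborel (ball p s) / measure lborel (ball q r) = (s / r) ^ DIM('a)"
  using assms by (simp add: content_ball power_divide unit_ball_vol_pos less_imp_neq[symmetric])

text \<open>Changing the radius of a large ball by a fixed \<open>d\<close> changes its volume by a
  factor tending to 1; boundary effects in the density estimates are removed this way.\<close>

lemma tendsto_shift_ratio_power: "((\<lambda>r. ((r + d) / r) ^ n) \<longlongrightarrow> (1::real)) at_top"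
proof -
  have "((\<lambda>r. (1 + d / r) ^ n) \<longlongrightarrow> (1 + 0) ^ n) at_top"
    by (intro tendsto_intros tendsto_divide_0[OF tendsto_const]
        filterlim_at_top_imp_at_infinity filterlim_ident)
  moreover have "eventually (\<lambda>r::real. (1 + d / r) ^ n = ((r + d) / r) ^ n) at_top"
    using eventually_gt_at_top[of 0] by eventually_elim (simp add: field_simps)
  ultimately show ?thesis by (simp add: filterlim_cong)
qed

section \<open>Densities of periodic packings\<close>

context packing_space
begin

definition vol :: real where "vol = measure lborel K"

lemma copy_measure: "A \<in> copies G K \<Longrightarrow> measure lborel A = vol"
  unfolding vol_def by (metis copyE compact_K measure_isometric_compact)

lemma copy_fmeasurable: "A \<in> copies G K \<Longrightarrow> A \<in> fmeasurable lborel"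
  using copy_compact fmeasurable_compact by blast

lemma vol_pos: "0 < vol"
proof -
  obtain x where "ball x inradius \<subseteq> K" using inradius by blast
  then have "measure lborel (ball x inradius) \<le> vol"
    unfolding vol_def by (intro measure_mono_fmeasurable fmeasurable_compact compact_K) auto
  then show ?thesis using measure_ball_pos[OF inradius(1), of x] by linarith
qed

lemma measure_ball_Int_copy_le: "A \<in> copies G K \<Longrightarrow> measure lborel (ball p r \<inter> A) \<le> vol"
  using copy_measure[of A] copy_fmeasurable[of A] copy_compact[of A]
  by (metis Int_lower2 measure_mono_fmeasurable open_ball borel_open borel_compact sets.Int sets_lborel)

lemma diameter_K_nonneg: "0 \<le> diameter K"
  by (simp add: diameter_ge_0 compact_imp_bounded compact_K)

lemma copy_meets_ball_subset:
  assumes "A \<in> copies G K" "A \<inter> ball p r \<noteq> {}"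
  shows "A \<subseteq> ball p (r + diameter K)"
proof
  obtain y where y: "y \<in> A" "dist p y < r" using assms by auto
  fix x assume "x \<in> A"
  then have "dist y x \<le> diameter K" using copy_diameter assms y by blast
  then show "x \<in> ball p (r + diameter K)"
    using dist_triangle[of p x y] y by auto
qed

lemma packing_meets_ball_finite:
  assumes "packing G K P"
  shows "finite {A \<in> P. A \<inter> ball p r \<noteq> {}}"
    "real (card {A \<in> P. A \<inter> ball p r \<noteq> {}}) * measure lborel (ball (0::'a) inradius)
      \<le> measure lborel (ball p (r + diameter K))"
  using packing_locally_finite[OF packing_subset[OF assms, of "{A \<in> P. A \<inter> ball p r \<noteq> {}}"], of p "r + diameter K"]
    copy_meets_ball_subset[OF packing_copies[OF assms]] by auto

lemma infsum_ball:
  assumes "packing G K P"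
  shows "(\<Sum>\<^sub>\<infinity>A\<in>P. measure lborel (ball p r \<inter> A)) =
      (\<Sum>A\<in>{A \<in> P. A \<inter> ball p r \<noteq> {}}. measure lborel (ball p r \<inter> A))"
proof -
  have "(\<Sum>\<^sub>\<infinity>A\<in>P. measure lborel (ball p r \<inter> A)) =
      (\<Sum>\<^sub>\<infinity>A\<in>{A \<in> P. A \<inter> ball p r \<noteq> {}}. measure lborel (ball p r \<inter> A))"
    by (rule infsum_cong_neutral) (auto simp: Int_commute)
  then show ?thesis using packing_meets_ball_finite[OF assms] by simp
qed

text \<open>Each element that meets the ball contributes at most \<open>vol\<close>, so counting is
  enough. The fixed widening \<open>d\<close> leaves room for boundary effects in the count and
  disappears in the limit.\<close>

lemma density_le:
  assumes P: "packing G K P" "has_density P c"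
    and C: "\<And>r. 0 < r \<Longrightarrow> real (card {A \<in> P. A \<inter> ball 0 r \<noteq> {}}) \<le> C * measure lborel (ball (0::'a) (r + d))"
    and "0 \<le> d"
  shows "c \<le> vol * C"
proof -
  let ?f = "\<lambda>r. (\<Sum>\<^sub>\<infinity>A\<in>P. measure lborel (ball 0 r \<inter> A)) / measure lborel (ball (0::'a) r)"
  have "(?f \<longlongrightarrow> c) at_top" using P by (simp add: has_density_def)
  moreover have "((\<lambda>r. vol * C * ((r + d) / r) ^ DIM('a)) \<longlongrightarrow> vol * C * 1) at_top"
    by (intro tendsto_intros tendsto_shift_ratio_power)
  moreover have "eventually (\<lambda>r. ?f r \<le> vol * C * ((r + d) / r) ^ DIM('a)) at_top"
    using eventually_gt_at_top[of 0]
  proof eventually_elim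
    case (elim r)
    have "(\<Sum>\<^sub>\<infinity>A\<in>P. measure lborel (ball 0 r \<inter> A)) \<le> (\<Sum>A\<in>{A \<in> P. A \<inter> ball 0 r \<noteq> {}}. vol)"
      unfolding infsum_ball[OF P(1)]
      using measure_ball_Int_copy_le packing_copies[OF P(1)] by (intro sum_mono) auto
    also have "\<dots> = vol * real (card {A \<in> P. A \<inter> ball 0 r \<noteq> {}})" by simp
    also have "\<dots> \<le> vol * (C * measure lborel (ball (0::'a) (r + d)))"
      using C[OF elim] vol_pos by (intro mult_left_mono) auto
    finally have "?f r \<le> vol * C * (measure lborel (ball (0::'a) (r + d)) / measure lborel (ball (0::'a) r))"
      using measure_ball_pos[OF elim, of "0::'a"] by (simp add: field_simps)
    then show ?case using measure_ball_ratio[OF elim, of "r + d" "0::'a" "0::'a"] elim assms(4) by simp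
  qed
  ultimately show ?thesis
    using tendsto_le[of at_top "\<lambda>r. vol * C * ((r + d) / r) ^ DIM('a)" "vol * C * 1" ?f c] by simp
qed

text \<open>A real supremum dominates its members only if the set is bounded above; counting
  disjoint balls of radius \<open>inradius\<close> gives the bound
  \<open>vol * (1 / v)\<close>.\<close>

lemma density_le_packing_density:
  assumes "packing G K P" "has_density P c"
  shows "c \<le> packing_density G K"
proof -
  define v where "v = measure lborel (ball (0::'a) inradius)"
  have v: "0 < v" using inradius by (simp add: v_def measure_ball_pos)
  have "c \<le> vol * (1 / v)" if "packing G K P" "has_density P c" for P c
  proof (rule density_le[OF that])
    show "real (card {A \<in> P. A \<inter> ball 0 r \<noteq> {}}) \<le> 1 / v * measure lborel (ball (0::'a) (r + diameter K))" for r
      using packing_meets_ball_finite(2)[OF that(1), of 0 r] v by (simp add: v_def field_simps)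
  qed (rule diameter_K_nonneg)
  then have "bdd_above {c. \<exists>P. packing G K P \<and> has_density P c}"
    by (intro bdd_aboveI[of _ "vol * (1 / v)"]) auto
  then show ?thesis
    unfolding packing_density_def using assms by (intro cSup_upper) auto
qed

text \<open>Lattice cubes inside a ball bound the covered volume from below, lattice cubes meeting
  it from above. Both totals agree with the volume of the ball up to a boundary layer of width
  \<open>d\<close>.\<close>

lemma periodic_packing:
  assumes F: "packing G K F" "finite F" "\<And>A. A \<in> F \<Longrightarrow> A \<subseteq> cube a l" and l: "0 < l"
  defines "P \<equiv> (\<lambda>(z, A). (+) z ` A) ` (cubic_lattice l \<times> F)"
  shows "packing G K P" "has_density P (real (card F) * vol / l ^ DIM('a))"
proof -
  have cF: "A \<in> copies G K" if "A \<in> F" for A using packing_copies F that by blast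
  have in_cube: "(+) z ` A \<subseteq> cube (a + z) l" if "A \<in> F" for z A
    using F(3)[OF that] cube_translateI by blast
  \<comment> \<open>Closed lattice cubes share faces, so disjointness comes from the open cubes,
    which contain the interiors of the copies.\<close>
  have in_open: "interior ((+) z ` A) \<subseteq> open_cube (a + z) l" if "A \<in> F" for z A
    using interior_mono[OF in_cube[OF that]] by (simp add: interior_cube)
  have disj: "interior ((+) z ` A) \<inter> interior ((+) w ` B) = {}"
    if "z \<in> cubic_lattice l" "w \<in> cubic_lattice l" "A \<in> F" "B \<in> F" "(z, A) \<noteq> (w, B)" for z w A B
  proof (cases "z = w")
    case True
    then have "interior A \<inter> interior B = {}"
      using F(1) that by (auto simp: packing_def pairwise_def)
    then show ?thesis using True by (auto simp: translate_interior)
  next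
    case False
    then show ?thesis
      using lattice_disjoint[OF l that(1,2)] in_open[OF that(3), of z] in_open[OF that(4), of w] by blast
  qed
  have cz: "(+) z ` A \<in> copies G K" if "A \<in> F" for z A
    using cF that by (simp add: copy_translate)
  have inj: "inj_on (\<lambda>(z, A). (+) z ` A) (cubic_lattice l \<times> F)"
  proof (rule inj_onI, clarify)
    fix z A w B assume h: "z \<in> cubic_lattice l" "A \<in> F" "w \<in> cubic_lattice l" "B \<in> F" "(+) z ` A = (+) w ` B"
    have "interior ((+) z ` A) \<noteq> {}"
      using copy_eq[OF cz[OF h(2)], of z] copy_nonempty[OF cz[OF h(2)], of z] by auto
    then show "z = w \<and> A = B" using disj[OF h(1,3,2,4)] h(5) by auto
  qed
  show pack: "packing G K P"
    unfolding packing_def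
  proof (intro conjI pairwiseI)
    show "P \<subseteq> copies G K" using cz by (auto simp: P_def)
    fix D E assume "D \<in> P" "E \<in> P" "D \<noteq> E"
    obtain z A where zA: "z \<in> cubic_lattice l" "A \<in> F" "D = (+) z ` A"
      using \<open>D \<in> P\<close> by (auto simp: P_def)
    obtain w B where wB: "w \<in> cubic_lattice l" "B \<in> F" "E = (+) w ` B"
      using \<open>E \<in> P\<close> by (auto simp: P_def)
    from zA wB \<open>D \<noteq> E\<close> have "(z, A) \<noteq> (w, B)" by auto
    from disj[OF zA(1) wB(1) zA(2) wB(2) this] show "interior D \<inter> interior E = {}"
      by (simp add: zA wB)
  qed
  have "((\<lambda>r. (\<Sum>\<^sub>\<infinity>D\<in>P. measure lborel (ball p r \<inter> D)) / measure lborel (ball p r))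
      \<longlongrightarrow> real (card F) * vol / l ^ DIM('a)) at_top" for p
  proof -
    define c where "c = real (card F) * vol / l ^ DIM('a)"
    \<comment> \<open>A bound for the diameter of a lattice cube: cubes meeting the ball lie in the
      ball widened by \<open>d\<close>, and cubes inside it cover the ball narrowed by
      \<open>d\<close>.\<close>
    define d where "d = l * DIM('a)"
    have d: "0 < d" using l by (simp add: d_def)
    let ?f = "\<lambda>r. (\<Sum>\<^sub>\<infinity>D\<in>P. measure lborel (ball p r \<inter> D)) / measure lborel (ball p r)"
    have bounds: "c * ((r - d) / r) ^ DIM('a) \<le> ?f r \<and> ?f r \<le> c * ((r + d) / r) ^ DIM('a)"
      if r: "d < r" for r
    proof -
      define Z1 where "Z1 = {z \<in> cubic_lattice l. cube (a + z) l \<subseteq> ball p r}"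
      define Z2 where "Z2 = {z \<in> cubic_lattice l. cube (a + z) l \<inter> ball p r \<noteq> {}}"
      have "a + z \<in> cube (a + z) l" for z using l by (auto simp: mem_cube)
      then have Z12: "Z1 \<subseteq> Z2" by (auto simp: Z1_def Z2_def)
      have Z2_bound: "real (card Z) * l ^ DIM('a) \<le> measure lborel (ball p (r + d))"
        if Z: "Z \<subseteq> Z2" "finite Z" for Z
      proof -
        have "real (card Z) * l ^ DIM('a) = (\<Sum>z\<in>Z. measure lborel (open_cube (a + z) l))"
          using l by (simp add: measure_cube)
        also have "\<dots> = measure lborel (\<Union>z\<in>Z. open_cube (a + z) l)"
        proof (rule measure_finite_Union[symmetric])
          show "disjoint_family_on (\<lambda>z. open_cube (a + z) l) Z"
            unfolding disjoint_family_on_def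
            using lattice_disjoint[OF l] Z by (auto simp: Z2_def)
        qed (use Z in \<open>auto simp: open_cube_def emeasure_lborel_box_eq\<close>)
        also have "\<dots> \<le> measure lborel (ball p (r + d))"
        proof (rule measure_mono_fmeasurable)
          show "(\<Union>z\<in>Z. open_cube (a + z) l) \<subseteq> ball p (r + d)"
          proof clarify
            fix z x assume "z \<in> Z" "x \<in> open_cube (a + z) l"
            then have x: "x \<in> cube (a + z) l" and "z \<in> Z2" using Z(1) open_cube_subset by blast+
            then obtain y where "y \<in> cube (a + z) l" "dist p y < r" by (auto simp: Z2_def)
            with x show "x \<in> ball p (r + d)"
              using cube_dist[of y "a + z" l x] dist_triangle[of p x y] by (simp add: d_def)
          qed
        qed (auto simp: open_cube_def intro!: borel_open open_UN fmeasurable_ball)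
        finally show ?thesis .
      qed
      have finZ2: "finite Z2"
      proof -
        have "card Z \<le> nat \<lceil>measure lborel (ball p (r + d)) / l ^ DIM('a)\<rceil>" if "Z \<subseteq> Z2" "finite Z" for Z
        proof -
          have "real (card Z) \<le> measure lborel (ball p (r + d)) / l ^ DIM('a)"
            using Z2_bound[OF that] l by (simp add: field_simps)
          then show ?thesis by linarith
        qed
        then show ?thesis by (meson finite_if_finite_subsets_card_bdd)
      qed
      have finZ1: "finite Z1" using finZ2 Z12 finite_subset by blast
      have Z1_bound: "measure lborel (ball p (r - d)) \<le> real (card Z1) * l ^ DIM('a)"
      proof -
        have "ball p (r - d) \<subseteq> (\<Union>z\<in>Z1. cube (a + z) l)"
        proof
          fix x assume x: "x \<in> ball p (r - d)"
          obtain z where z: "z \<in> cubic_lattice l" "x \<in> cube (a + z) l" using lattice_cover[OF l] by blast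
          have "cube (a + z) l \<subseteq> ball p r"
          proof
            fix y assume "y \<in> cube (a + z) l"
            then show "y \<in> ball p r"
              using cube_dist[OF z(2)] x dist_triangle[of p y x] by (fastforce simp: d_def)
          qed
          then show "x \<in> (\<Union>z\<in>Z1. cube (a + z) l)" using z by (auto simp: Z1_def)
        qed
        then have "measure lborel (ball p (r - d)) \<le> measure lborel (\<Union>z\<in>Z1. cube (a + z) l)"
          using finZ1 by (intro measure_mono_fmeasurable fmeasurable.finite_UN) (auto simp: cube_def)
        also have "\<dots> \<le> (\<Sum>z\<in>Z1. measure lborel (cube (a + z) l))"
          using finZ1 by (intro measure_UNION_le) (auto simp: cube_def)
        finally show ?thesis using l by (simp add: measure_cube)
      qed
      define f where "f D = measure lborel (ball p r \<inter> D)" for D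
      have "(\<Sum>\<^sub>\<infinity>D\<in>P. f D) = (\<Sum>\<^sub>\<infinity>D\<in>(\<lambda>(z, A). (+) z ` A) ` (Z2 \<times> F). f D)"
      proof (rule infsum_cong_neutral)
        fix D assume "D \<in> P - (\<lambda>(z, A). (+) z ` A) ` (Z2 \<times> F)"
        then obtain z A where "z \<in> cubic_lattice l" "A \<in> F" "D = (+) z ` A" "z \<notin> Z2"
          unfolding P_def by force
        then have "ball p r \<inter> D = {}" using in_cube[of A z] by (auto simp: Z2_def)
        then show "f D = 0" by (simp add: f_def)
      qed (auto simp: P_def Z2_def)
      also have "\<dots> = (\<Sum>D\<in>(\<lambda>(z, A). (+) z ` A) ` (Z2 \<times> F). f D)"
        using finZ2 F by simp
      also have "\<dots> = (\<Sum>(z, A)\<in>Z2 \<times> F. f ((+) z ` A))"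
      proof (subst sum.reindex)
        show "inj_on (\<lambda>(z, A). (+) z ` A) (Z2 \<times> F)"
          by (rule inj_on_subset[OF inj]) (auto simp: Z2_def)
      qed (simp add: o_def split_def)
      finally have sum: "(\<Sum>\<^sub>\<infinity>D\<in>P. f D) = (\<Sum>(z, A)\<in>Z2 \<times> F. f ((+) z ` A))" .
      have up: "(\<Sum>\<^sub>\<infinity>D\<in>P. f D) \<le> c * measure lborel (ball p (r + d))"
      proof -
        have "(\<Sum>\<^sub>\<infinity>D\<in>P. f D) \<le> (\<Sum>(z, A)\<in>Z2 \<times> F. vol)"
          unfolding sum using measure_ball_Int_copy_le[OF cz] by (intro sum_mono) (auto simp: f_def)
        also have "\<dots> = c * (real (card Z2) * l ^ DIM('a))"
          using l by (simp add: c_def card_cartesian_product split_def)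
        also have "\<dots> \<le> c * measure lborel (ball p (r + d))"
          using Z2_bound[OF order_refl finZ2] vol_pos l by (intro mult_left_mono) (auto simp: c_def)
        finally show ?thesis .
      qed
      have low: "c * measure lborel (ball p (r - d)) \<le> (\<Sum>\<^sub>\<infinity>D\<in>P. f D)"
      proof -
        have "c * measure lborel (ball p (r - d)) \<le> c * (real (card Z1) * l ^ DIM('a))"
          using Z1_bound vol_pos l by (intro mult_left_mono) (auto simp: c_def)
        also have "\<dots> = (\<Sum>(z, A)\<in>Z1 \<times> F. vol)"
          using l by (simp add: c_def card_cartesian_product split_def)
        also have "\<dots> = (\<Sum>(z, A)\<in>Z1 \<times> F. f ((+) z ` A))"
        proof (rule sum.cong, simp, clarify)
          fix z A assume "z \<in> Z1" "A \<in> F"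
          then have "ball p r \<inter> (+) z ` A = (+) z ` A" using in_cube[of A z] by (auto simp: Z1_def)
          then show "vol = f ((+) z ` A)" using copy_measure[OF cz[OF \<open>A \<in> F\<close>]] by (simp add: f_def)
        qed
        also have "\<dots> \<le> (\<Sum>(z, A)\<in>Z2 \<times> F. f ((+) z ` A))"
          using Z12 finZ2 F by (intro sum_mono2) (auto simp: f_def)
        finally show ?thesis unfolding sum .
      qed
      have r0: "0 < r" "0 \<le> r - d" "0 \<le> r + d" using r d by auto
      have f_eq: "(\<Sum>\<^sub>\<infinity>D\<in>P. measure lborel (ball p r \<inter> D)) = (\<Sum>\<^sub>\<infinity>D\<in>P. f D)"
        by (simp add: f_def)
      show ?thesis
        unfolding f_eq using divide_right_mono[OF up, of "measure lborel (ball p r)"]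
          divide_right_mono[OF low, of "measure lborel (ball p r)"]
          measure_ball_ratio[OF r0(1,2), of p p] measure_ball_ratio[OF r0(1,3), of p p]
        by (simp flip: times_divide_eq_right)
    qed
    show ?thesis
      unfolding c_def[symmetric]
    proof (rule tendsto_sandwich)
      show "eventually (\<lambda>r. c * ((r - d) / r) ^ DIM('a) \<le> ?f r) at_top"
        using eventually_gt_at_top[of d] by eventually_elim (simp only: bounds)
      show "eventually (\<lambda>r. ?f r \<le> c * ((r + d) / r) ^ DIM('a)) at_top"
        using eventually_gt_at_top[of d] by eventually_elim (simp only: bounds)
      show "((\<lambda>r. c * ((r - d) / r) ^ DIM('a)) \<longlongrightarrow> c) at_top"
        using tendsto_mult_left[OF tendsto_shift_ratio_power[of "- d" "DIM('a)"], of c] by simp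
      show "((\<lambda>r. c * ((r + d) / r) ^ DIM('a)) \<longlongrightarrow> c) at_top"
        using tendsto_mult_left[OF tendsto_shift_ratio_power[of d "DIM('a)"], of c] by simp
    qed
  qed
  then show "has_density P (real (card F) * vol / l ^ DIM('a))"
    by (simp add: has_density_def)
qed

text \<open>The periodic repetition of \<open>F\<close> is a packing that has a density, so the
  supremum dominates it. This turns a surplus of copies in one cube into a lower bound for
  \<open>packing_density G K\<close>.\<close>

lemma card_in_cube_le:
  assumes F: "packing G K F" "finite F" "\<And>A. A \<in> F \<Longrightarrow> A \<subseteq> cube a l" and l: "0 < l"
  shows "real (card F) * vol \<le> packing_density G K * l ^ DIM('a)"
  using density_le_packing_density[OF periodic_packing[OF F l]] l by (simp add: field_simps)

end

section \<open>Counting copies after simultaneous swaps\<close>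

context packing_space
begin

text \<open>The disjoint regions \<open>U i\<close> keep the swaps from interfering. An inserted
  copy is disjoint from those inserted in other regions, and all remaining elements belong to the
  packing produced by its own swap alone. The finite window \<open>P1\<close> makes the gain of one
  copy per region countable.\<close>

lemma simultaneous_swap:
  assumes P: "packing G K P" and I: "finite I"
    and S: "\<And>i. i \<in> I \<Longrightarrow> S i \<subseteq> P1" and P1: "P1 \<subseteq> P" "finite P1"
    and T: "\<And>i. i \<in> I \<Longrightarrow> T i \<subseteq> copies G K" "\<And>i. i \<in> I \<Longrightarrow> card (T i) = Suc (card (S i))"
      "\<And>i. i \<in> I \<Longrightarrow> T i \<inter> (P - S i) = {}" "\<And>i. i \<in> I \<Longrightarrow> packing G K ((P - S i) \<union> T i)"
    and U: "\<And>i A. i \<in> I \<Longrightarrow> A \<in> S i \<union> T i \<Longrightarrow> A \<subseteq> U i"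
      "\<And>i j. i \<in> I \<Longrightarrow> j \<in> I \<Longrightarrow> i \<noteq> j \<Longrightarrow> U i \<inter> U j = {}"
  defines "F \<equiv> (P1 - (\<Union>i\<in>I. S i)) \<union> (\<Union>i\<in>I. T i)"
  shows "packing G K F" "finite F" "card F = card P1 + card I"
proof -
  have finS: "finite (S i)" if "i \<in> I" for i using S[OF that] P1(2) finite_subset by blast
  have finT: "finite (T i)" if "i \<in> I" for i
    using T(2)[OF that] by (metis card.infinite nat.distinct(1))
  have ne: "A \<noteq> {}" if "i \<in> I" "A \<in> S i \<union> T i" for i A
  proof -
    have "A \<in> copies G K"
      using that(2) S[OF that(1)] T(1)[OF that(1)] P1(1) packing_copies[OF P, of A] by auto
    then show ?thesis by (rule copy_nonempty)
  qed
  have dis: "S i \<inter> S j = {} \<and> T i \<inter> T j = {}" if "i \<in> I" "j \<in> I" "i \<noteq> j" for i j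
  proof -
    have "A \<notin> S j \<union> T j" if "A \<in> S i \<union> T i" for A
      using U(1)[OF \<open>i \<in> I\<close> that] U(1)[OF \<open>j \<in> I\<close>, of A] U(2)[OF \<open>i \<in> I\<close> \<open>j \<in> I\<close> \<open>i \<noteq> j\<close>]
        ne[OF \<open>i \<in> I\<close> that] by auto
    then show ?thesis by blast
  qed
  show "packing G K F"
    unfolding packing_def
  proof (intro conjI pairwiseI)
    show "F \<subseteq> copies G K" using T(1) packing_copies[OF P] P1 by (auto simp: F_def)
    have T_rest: "interior A \<inter> interior B = {}" if "i \<in> I" "A \<in> T i" "B \<in> F" "A \<noteq> B" for i A B
    proof (cases "\<exists>j\<in>I. B \<in> T j \<and> j \<noteq> i")
      case True
      then obtain j where "j \<in> I" "B \<in> T j" "j \<noteq> i" by blast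
      then have "A \<inter> B = {}" using U(1)[of i A] U(1)[of j B] U(2)[of i j] that by blast
      then show ?thesis using interior_subset by blast
    next
      case False
      then have "B \<in> (P - S i) \<union> T i" using that P1 by (auto simp: F_def)
      then show ?thesis
        using T(4)[OF that(1)] that by (auto simp: packing_def pairwise_def)
    qed
    fix A B assume AB: "A \<in> F" "B \<in> F" "A \<noteq> B"
    show "interior A \<inter> interior B = {}"
    proof (cases "(\<exists>i\<in>I. A \<in> T i) \<or> (\<exists>i\<in>I. B \<in> T i)")
      case True
      then show ?thesis using T_rest AB by (metis Int_commute)
    next
      case False
      then have "A \<in> P" "B \<in> P" using AB P1 by (auto simp: F_def)
      then show ?thesis using P AB(3) by (auto simp: packing_def pairwise_def)
    qed
  qed
  show "finite F" using I P1 finT by (auto simp: F_def)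
  \<comment> \<open>An inserted copy may be one of the removed ones, but never one of those that
    remain, so the two parts do not overlap.\<close>
  have "card F = card (P1 - (\<Union>i\<in>I. S i)) + card (\<Union>i\<in>I. T i)"
    unfolding F_def using I P1 finT T(3) by (intro card_Un_disjoint) (auto, blast)
  also have "card (\<Union>i\<in>I. T i) = (\<Sum>i\<in>I. card (T i))"
    using I finT dis by (intro card_UN_disjoint) auto
  also have "\<dots> = (\<Sum>i\<in>I. card (S i)) + card I"
    using T(2) by (simp add: sum_Suc)
  also have "(\<Sum>i\<in>I. card (S i)) = card (\<Union>i\<in>I. S i)"
    using I finS dis by (intro card_UN_disjoint[symmetric]) auto
  finally have "card F = card (P1 - (\<Union>i\<in>I. S i)) + card (\<Union>i\<in>I. S i) + card I" by simp
  moreover have "card (P1 - (\<Union>i\<in>I. S i)) + card (\<Union>i\<in>I. S i) = card P1"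
    using card_Diff_subset[of "\<Union>i\<in>I. S i" P1] card_mono[OF P1(2), of "\<Union>i\<in>I. S i"] S I finS by (simp add: UN_least)
  ultimately show "card F = card P1 + card I" by simp
qed

lemma swappable_untranslate:
  assumes "swappable m (translate (- v) P)"
  obtains S T where "S \<subseteq> P" "T \<subseteq> copies G K" "card T = Suc (card S)" "T \<inter> (P - S) = {}"
    "packing G K ((P - S) \<union> T)" "\<forall>A\<in>S \<union> T. A \<subseteq> cball v m"
proof -
  define f where "f = image ((+) v)"
  have inj: "inj f" by (rule injI) (simp add: f_def inj_image_eq_iff)
  have tr: "translate v Q = f ` Q" for Q by (simp add: translate_def f_def)
  have P: "f ` translate (- v) P = P" unfolding tr[symmetric] by simp
  obtain S T where ST: "S \<subseteq> translate (- v) P" "T \<subseteq> copies G K" "card T = Suc (card S)"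
    "T \<inter> (translate (- v) P - S) = {}" "packing G K ((translate (- v) P - S) \<union> T)"
    "\<forall>A\<in>S \<union> T. A \<subseteq> cball 0 m"
    using assms unfolding swappable_def by blast
  have diff: "f ` (translate (- v) P - S) = P - f ` S"
    by (simp add: image_set_diff[OF inj] P)
  show thesis
  proof (rule that[of "f ` S" "f ` T"])
    show "f ` S \<subseteq> P" using ST(1) P by blast
    show "f ` T \<subseteq> copies G K" using ST(2) copy_translate by (auto simp: f_def)
    show "card (f ` T) = Suc (card (f ` S))"
      using ST(3) inj by (simp add: card_image inj_on_subset[OF inj])
    show "f ` T \<inter> (P - f ` S) = {}"
      unfolding diff[symmetric] using ST(4) by (simp flip: image_Int[OF inj])
    show "packing G K (P - f ` S \<union> f ` T)"
      using packing_translate[OF ST(5), of v] unfolding tr image_Un diff .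
    show "\<forall>A\<in>f ` S \<union> f ` T. A \<subseteq> cball v m"
      using ST(6) by (force simp: f_def subset_iff dist_norm)
  qed
qed

text \<open>Not a geometric centre, just a fixed point of each copy. It allows copies to be counted
  by the position of one point, without a rule for copies that cross the boundary of a cube.\<close>

definition centre :: "'a set \<Rightarrow> 'a" where "centre A = (SOME x. x \<in> A)"

lemma centre_in: "A \<in> copies G K \<Longrightarrow> centre A \<in> A"
  by (simp add: centre_def some_in_eq copy_nonempty)

lemma finite_centre_in_cube:
  assumes "packing G K P"
  shows "finite {A \<in> P. centre A \<in> cube x l}"
proof -
  obtain r where r: "cube x l \<subseteq> ball 0 r"
    using bounded_subset_ballD[of "cube x l" 0] by (auto simp: cube_def)
  have "{A \<in> P. centre A \<in> cube x l} \<subseteq> {A \<in> P. A \<inter> ball 0 r \<noteq> {}}"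
    using r centre_in packing_copies[OF assms] by blast
  then show ?thesis using packing_meets_ball_finite(1)[OF assms] finite_subset by blast
qed

lemma cball_subset_open_cube:
  fixes c :: "'a::euclidean_space"
  assumes "dist v (c + (q / 2) *\<^sub>R One) \<le> L" "L + m < q / 2"
  shows "cball v m \<subseteq> open_cube c q"
proof
  fix x assume x: "x \<in> cball v m"
  have d: "dist x (c + (q / 2) *\<^sub>R One) < q / 2"
    using dist_triangle[of x "c + (q / 2) *\<^sub>R One" v] x assms by (simp add: dist_commute)
  show "x \<in> open_cube c q"
    unfolding mem_open_cube
  proof
    fix b :: 'a assume b: "b \<in> Basis"
    have "\<bar>(x - (c + (q / 2) *\<^sub>R One)) \<bullet> b\<bar> < q / 2"
      using Basis_le_norm[OF b, of "x - (c + (q / 2) *\<^sub>R One)"] d by (simp add: dist_norm)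
    then have "\<bar>x \<bullet> b - (c \<bullet> b + q / 2)\<bar> < q / 2"
      using b by (simp add: inner_diff_left inner_add_left)
    then show "c \<bullet> b < x \<bullet> b \<and> x \<bullet> b < c \<bullet> b + q" by linarith
  qed
qed

text \<open>The cube of side \<open>real j * q\<close> is divided into \<open>j ^ DIM('a)\<close>
  cells, each wide enough for a swap. One swap per cell adds one copy per cell, and all resulting
  copies lie in the cube widened by \<open>diameter K\<close> on every side, where
  \<open>card_in_cube_le\<close> limits their number.\<close>

lemma swaps_bound_cube_count:
  assumes P: "packing G K P"
    and swaps: "\<And>s. \<exists>w. norm w \<le> L \<and> swappable m (translate (s + w) P)"
    and q: "0 < q" "L + m < q / 2" and j: "0 < j"
  shows "(real (card {A \<in> P. centre A \<in> cube a (real j * q)}) + real j ^ DIM('a)) * vol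
    \<le> packing_density G K * (real j * q + 2 * diameter K) ^ DIM('a)"
proof -
  define l where "l = real j * q"
  define P1 where "P1 = {A \<in> P. centre A \<in> cube a l}"
  define I where "I = (Basis :: 'a set) \<rightarrow>\<^sub>E {..<j}"
  define x where "x k = a + (\<Sum>b\<in>Basis. (real (k b) * q) *\<^sub>R b)" for k :: "'a \<Rightarrow> nat"
  have x: "x k \<bullet> b = a \<bullet> b + real (k b) * q" if "b \<in> Basis" for k b
    using that by (simp add: x_def inner_add_left)
  have I: "finite I" "card I = j ^ DIM('a)"
    by (simp_all add: I_def finite_PiE card_PiE)
  have ex: "\<exists>S T. S \<subseteq> P \<and> T \<subseteq> copies G K \<and> card T = Suc (card S) \<and> T \<inter> (P - S) = {} \<and>
    packing G K ((P - S) \<union> T) \<and> (\<forall>A\<in>S \<union> T. A \<subseteq> open_cube (x k) q)" for k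
  proof -
    \<comment> \<open>The midpoint of the cell. A swap of the translate by \<open>- c + w\<close>
      takes place in \<open>P\<close> about \<open>c - w\<close>, a point within \<open>L\<close> of
      \<open>c\<close>.\<close>
    define c where "c = x k + (q / 2) *\<^sub>R One"
    obtain w where w: "norm w \<le> L" "swappable m (translate (- c + w) P)" using swaps by blast
    then have "swappable m (translate (- (c - w)) P)" by simp
    then obtain S T where ST: "S \<subseteq> P" "T \<subseteq> copies G K" "card T = Suc (card S)" "T \<inter> (P - S) = {}"
      "packing G K ((P - S) \<union> T)" "\<forall>A\<in>S \<union> T. A \<subseteq> cball (c - w) m"
      by (rule swappable_untranslate)
    have "cball (c - w) m \<subseteq> open_cube (x k) q"
      using cball_subset_open_cube[of "c - w" "x k" q L m] w q by (simp add: c_def dist_norm)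
    with ST(6) have "\<forall>A\<in>S \<union> T. A \<subseteq> open_cube (x k) q" by (meson subset_trans)
    with ST(1-5) show ?thesis by (intro exI[of _ S] exI[of _ T]) simp
  qed
  then obtain S T where ST: "\<And>k. S k \<subseteq> P" "\<And>k. T k \<subseteq> copies G K" "\<And>k. card (T k) = Suc (card (S k))"
    "\<And>k. T k \<inter> (P - S k) = {}" "\<And>k. packing G K ((P - S k) \<union> T k)"
    "\<And>k A. A \<in> S k \<union> T k \<Longrightarrow> A \<subseteq> open_cube (x k) q"
    by metis
  have sub: "open_cube (x k) q \<subseteq> cube a l" if "k \<in> I" for k
  proof
    fix y assume y: "y \<in> open_cube (x k) q"
    show "y \<in> cube a l"
      unfolding mem_cube
    proof
      fix b :: 'a assume b: "b \<in> Basis"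
      then have "k b + 1 \<le> j" using that by (auto simp: I_def PiE_iff)
      then have "real (k b) + 1 \<le> real j" by linarith
      then have "(real (k b) + 1) * q \<le> l" unfolding l_def using q by (intro mult_right_mono) auto
      then have "real (k b) * q + q \<le> l" by (simp add: distrib_right)
      moreover have "a \<bullet> b + real (k b) * q < y \<bullet> b \<and> y \<bullet> b < a \<bullet> b + real (k b) * q + q"
        using y b x[OF b] by (auto simp: mem_open_cube)
      moreover have "0 \<le> real (k b) * q" using q by simp
      ultimately show "a \<bullet> b \<le> y \<bullet> b \<and> y \<bullet> b \<le> a \<bullet> b + l" by linarith
    qed
  qed
  have dis: "open_cube (x k) q \<inter> open_cube (x k') q = {}" if k: "k \<in> I" "k' \<in> I" "k \<noteq> k'" for k k'
  proof -
    obtain b where b: "b \<in> Basis" "k b \<noteq> k' b"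
      using k by (auto simp: I_def) (metis PiE_ext)
    have "\<not> (k b < k' b)" if "y \<in> open_cube (x k) q" "y \<in> open_cube (x k') q" for y k k'
    proof
      assume "k b < k' b"
      then have "(real (k b) + 1) * q \<le> real (k' b) * q" using q by (intro mult_right_mono) auto
      moreover have "y \<bullet> b < a \<bullet> b + real (k b) * q + q" "a \<bullet> b + real (k' b) * q < y \<bullet> b"
        using that b(1) x[OF b(1)] by (auto simp: mem_open_cube)
      ultimately show False by (simp add: distrib_right)
    qed
    then show ?thesis using b(2) by (metis disjoint_iff linorder_neqE_nat)
  qed
  have P1: "P1 \<subseteq> P" "finite P1" using finite_centre_in_cube[OF P] by (auto simp: P1_def)
  have SP1: "S k \<subseteq> P1" if "k \<in> I" for k
  proof
    fix A assume A: "A \<in> S k"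
    then have "A \<in> P" "A \<subseteq> cube a l" using ST(1) ST(6)[of A k] sub[OF that] by blast+
    then show "A \<in> P1" using centre_in packing_copies[OF P] by (auto simp: P1_def)
  qed
  define F where "F = (P1 - (\<Union>k\<in>I. S k)) \<union> (\<Union>k\<in>I. T k)"
  have F: "packing G K F" "finite F" "card F = card P1 + card I"
    unfolding F_def
    by (rule simultaneous_swap[OF P I(1) SP1 P1, where U = "\<lambda>k. open_cube (x k) q"]; use ST dis in blast)+
  define D where "D = diameter K"
  have D: "0 \<le> D" unfolding D_def by (rule diameter_K_nonneg)
  have big: "A \<subseteq> cube (a - D *\<^sub>R One) (l + 2 * D)" if AF: "A \<in> F" for A
  proof -
    have "\<exists>c\<in>cube a l. \<forall>y\<in>A. dist c y \<le> D"
    proof (cases "A \<in> P1")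
      case True
      then show ?thesis
        using centre_in copy_diameter packing_copies[OF P] unfolding P1_def D_def by blast
    next
      case False
      then obtain k where k: "k \<in> I" "A \<in> T k" using AF by (auto simp: F_def)
      then have "A \<in> copies G K" "A \<subseteq> cube a l" using ST(2) ST(6)[of A k] sub[of k] by blast+
      then show ?thesis using centre_in copy_diameter unfolding D_def by blast
    qed
    then obtain c where c: "c \<in> cube a l" "\<And>y. y \<in> A \<Longrightarrow> dist c y \<le> D" by blast
    show ?thesis
    proof
      fix y assume y: "y \<in> A"
      show "y \<in> cube (a - D *\<^sub>R One) (l + 2 * D)"
        unfolding mem_cube
      proof
        fix b :: 'a assume b: "b \<in> Basis"
        have "\<bar>(c - y) \<bullet> b\<bar> \<le> D"
          using Basis_le_norm[OF b, of "c - y"] c(2)[OF y] by (simp add: dist_norm)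
        moreover have "a \<bullet> b \<le> c \<bullet> b \<and> c \<bullet> b \<le> a \<bullet> b + l" using c(1) b by (simp add: mem_cube)
        ultimately show "(a - D *\<^sub>R One) \<bullet> b \<le> y \<bullet> b \<and> y \<bullet> b \<le> (a - D *\<^sub>R One) \<bullet> b + (l + 2 * D)"
          using b by (simp add: inner_diff_left abs_le_iff)
      qed
    qed
  qed
  have "0 < l" using q j by (simp add: l_def)
  then have "real (card F) * vol \<le> packing_density G K * (l + 2 * D) ^ DIM('a)"
    using D by (intro card_in_cube_le[OF F(1,2) big]) auto
  then show ?thesis
    using F(3) I(2) by (simp add: P1_def l_def D_def)
qed

text \<open>Double counting over all positions of the cube: a copy is counted by
  \<open>cube y l\<close> for corners \<open>y\<close> filling volume \<open>l ^ DIM('a)\<close>,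
  while each position counts at most \<open>M\<close> copies. Integration over \<open>y\<close>
  compares the two.\<close>

lemma density_le_of_cube_count:
  assumes P: "packing G K P" "has_density P c" and l: "0 < l" and "0 \<le> M"
    and count: "\<And>a. real (card {A \<in> P. centre A \<in> cube a l}) \<le> M"
  shows "c \<le> vol * (M / l ^ DIM('a))"
proof (rule density_le[OF P, where d = "diameter K + l * DIM('a)"])
  show "0 \<le> diameter K + l * DIM('a)" using diameter_K_nonneg l by simp
  fix r :: real assume "0 < r"
  define R where "R = r + (diameter K + l * DIM('a))"
  define H where "H = {A \<in> P. A \<inter> ball 0 r \<noteq> {}}"
  have H: "finite H" unfolding H_def by (rule packing_meets_ball_finite(1)[OF P(1)])
  \<comment> \<open>The corners \<open>y\<close> for which \<open>cube y l\<close> contains the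
    centre of \<open>A\<close>; they form a cube of the same side whose upper corner is that
    centre.\<close>
  define C where "C A = cube (centre A - l *\<^sub>R One) l" for A :: "'a set"
  have C_iff: "y \<in> C A \<longleftrightarrow> centre A \<in> cube y l" for y A
    unfolding C_def mem_cube by (auto simp: inner_diff_left)
  have Cf: "C A \<in> fmeasurable lborel" for A by (simp add: C_def cube_def)
  have pointwise: "(\<Sum>A\<in>H. indicator (C A) y) \<le> M * indicator (ball 0 R) y" for y :: 'a
  proof (cases "y \<in> ball 0 R")
    case True
    have "(\<Sum>A\<in>H. indicator (C A) y :: real) = real (card {A \<in> H. y \<in> C A})"
      using H by (simp add: indicator_def sum.If_cases Int_def)
    also have "\<dots> \<le> real (card {A \<in> P. centre A \<in> cube y l})"
      unfolding C_iff
      by (intro of_nat_mono card_mono finite_centre_in_cube P(1)) (auto simp: H_def)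
    also have "\<dots> \<le> M" by (rule count)
    finally show ?thesis using True by simp
  next
    case False
    have "y \<notin> C A" if "A \<in> H" for A
    proof
      assume y: "y \<in> C A"
      have A: "A \<in> copies G K" "A \<subseteq> ball 0 (r + diameter K)"
        using that packing_copies[OF P(1)] copy_meets_ball_subset by (auto simp: H_def)
      have "y \<in> cube y l" using l by (simp add: mem_cube)
      then have "dist y (centre A) \<le> l * DIM('a)"
        using y cube_dist by (auto simp: C_iff)
      moreover have "dist 0 (centre A) < r + diameter K" using subsetD[OF A(2) centre_in[OF A(1)]] by simp
      ultimately have "y \<in> ball 0 R"
        using dist_triangle[of 0 y "centre A"] by (simp add: R_def dist_commute)
      with False show False by simp
    qed
    then show ?thesis using False by simp
  qed
  have "real (card H) * l ^ DIM('a) = (\<Sum>A\<in>H. measure lborel (C A))"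
    using l by (simp add: C_def measure_cube)
  also have "\<dots> = (\<integral>y. (\<Sum>A\<in>H. indicator (C A) y) \<partial>lborel)"
    using Cf by (subst Bochner_Integration.integral_sum) (auto simp: fmeasurable_def)
  also have "\<dots> \<le> (\<integral>y. M * indicator (ball (0::'a) R) y \<partial>lborel)"
  proof (rule Bochner_Integration.integral_mono)
    show "integrable lborel (\<lambda>y. \<Sum>A\<in>H. indicator (C A) y :: real)"
      using Cf by (intro Bochner_Integration.integrable_sum) (simp add: fmeasurable_def)
    show "integrable lborel (\<lambda>y. M * indicator (ball (0::'a) R) y)"
      using fmeasurable_ball[of "0::'a" R] by (simp add: fmeasurable_def)
  qed (rule pointwise)
  also have "\<dots> = M * measure lborel (ball (0::'a) R)" by simp
  finally show "real (card {A \<in> P. A \<inter> ball 0 r \<noteq> {}})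
      \<le> M / l ^ DIM('a) * measure lborel (ball (0::'a) (r + (diameter K + l * DIM('a))))"
    using l by (simp add: H_def R_def field_simps)
qed

lemma dense_packing_swaps_not_relatively_dense:
  assumes P: "dense_packing G K P"
  shows "\<exists>s. \<forall>w. norm w \<le> L \<longrightarrow> \<not> swappable m (translate (s + w) P)"
proof (rule ccontr)
  assume "\<not> ?thesis"
  then have swaps: "\<And>s. \<exists>w. norm w \<le> L \<and> swappable m (translate (s + w) P)" by blast
  \<comment> \<open>A cell of this side holds a swap of radius \<open>m\<close> whose centre is
    displaced by up to \<open>L\<close>. Absolute values are taken since neither number is assumed
    nonnegative.\<close>
  define q where "q = 2 * (\<bar>L\<bar> + \<bar>m\<bar>) + 1"
  have q: "0 < q" "L + m < q / 2" by (auto simp: q_def)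
  define \<delta> where "\<delta> = packing_density G K"
  define D where "D = diameter K"
  have pack: "packing G K P" and dens: "has_density P \<delta>"
    using P by (auto simp: dense_packing_def \<delta>_def)
  \<comment> \<open>Per unit volume, one extra copy in each cell gains
    \<open>vol / q ^ DIM('a)\<close> whatever \<open>j\<close> is, while the widening by
    \<open>2 * D\<close> costs a factor tending to 1. For some \<open>j\<close> the gain
    prevails.\<close>
  have "((\<lambda>j. \<delta> * ((real j * q + 2 * D) / (real j * q)) ^ DIM('a) - vol / q ^ DIM('a))
      \<longlongrightarrow> \<delta> * 1 - vol / q ^ DIM('a)) sequentially"
  proof (intro tendsto_intros)
    have "filterlim (\<lambda>j. real j * q) at_top sequentially"
      using filterlim_tendsto_pos_mult_at_top[OF tendsto_const q(1) filterlim_real_sequentially]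
      by (simp add: mult.commute)
    then show "((\<lambda>j. ((real j * q + 2 * D) / (real j * q)) ^ DIM('a)) \<longlongrightarrow> 1) sequentially"
      using filterlim_compose[OF tendsto_shift_ratio_power] by blast
  qed
  moreover have "\<delta> * 1 - vol / q ^ DIM('a) < \<delta>" using vol_pos q by simp
  ultimately have "eventually (\<lambda>j. \<delta> * ((real j * q + 2 * D) / (real j * q)) ^ DIM('a) - vol / q ^ DIM('a) < \<delta>) sequentially"
    by (rule order_tendstoD(2))
  then have "eventually (\<lambda>j. \<delta> * ((real j * q + 2 * D) / (real j * q)) ^ DIM('a) - vol / q ^ DIM('a) < \<delta> \<and> 0 < j) sequentially"
    using eventually_gt_at_top[of 0] by (rule eventually_conj)
  then obtain j where j: "\<delta> * ((real j * q + 2 * D) / (real j * q)) ^ DIM('a) - vol / q ^ DIM('a) < \<delta>" "0 < j"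
    by (auto simp: eventually_sequentially)
  define l where "l = real j * q"
  have l: "0 < l" using j q by (simp add: l_def)
  define M where "M = \<delta> * (l + 2 * D) ^ DIM('a) / vol - real j ^ DIM('a)"
  have count: "real (card {A \<in> P. centre A \<in> cube a l}) \<le> M" for a
    using swaps_bound_cube_count[OF pack swaps q j(2), of a] vol_pos
    by (simp add: M_def l_def \<delta>_def D_def field_simps)
  have "0 \<le> M" using order_trans[OF _ count[of 0]] by simp
  have "\<delta> \<le> vol * (M / l ^ DIM('a))"
    by (rule density_le_of_cube_count[OF pack dens l \<open>0 \<le> M\<close> count])
  also have "\<dots> = \<delta> * ((l + 2 * D) / l) ^ DIM('a) - vol * (real j / l) ^ DIM('a)"
  proof -
    have "vol * M = \<delta> * (l + 2 * D) ^ DIM('a) - vol * real j ^ DIM('a)"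
      using vol_pos by (simp add: M_def right_diff_distrib)
    then show ?thesis by (simp add: power_divide diff_divide_distrib)
  qed
  also have "real j / l = 1 / q" using j by (simp add: l_def)
  also have "\<delta> * ((l + 2 * D) / l) ^ DIM('a) - vol * (1 / q) ^ DIM('a) < \<delta>"
    using j(1) by (simp add: l_def power_divide)
  finally show False by simp
qed

end

(* "closed G" refers to pointwise convergence, i.e. to the product topology on functions;
   on isometries this is the usual topology.  Limits of packings by copies under G need not
   be packings by copies under G without it. *)
theorem theorem3:
  fixes G :: "('a::euclidean_space \<Rightarrow> 'a) set" and K :: "'a set" and P :: "'a set set"
  assumes "allowed_isometry_group G"
    and "closed G"
    and "body K"
    and "self_nesting G K"
    and "packing G K P"
    and "uniformly_recurrent G K P"
    and "dense_packing G K P"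
  shows "\<exists>Q. packing G K Q \<and> completely_saturated G K Q \<and> limit_equivalent P Q"
proof -
  interpret packing_space G K by standard (fact assms)+
  obtain Q where Q: "packing G K Q" "limit_of Q P" "\<And>k::nat. \<not> swappable (real k) Q"
    by (rule limit_without_swaps[OF assms(5,6) dense_packing_swaps_not_relatively_dense[OF assms(7)]])
      (rule that)
  have "completely_saturated G K Q"
    using not_completely_saturated_swappable[OF Q(1)] Q(3) by blast
  moreover have "limit_of P Q"
    using assms(6) Q(1,2) by (simp add: uniformly_recurrent_def)
  ultimately show ?thesis
    using Q(1,2) by (auto simp: limit_equivalent_def)
qed

end
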